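(* Let $g:S^1\to\mathbb{R}$ be a smooth, $\pi$-periodic function with $g>0$ and $g+g''>0$, and let $u_0:S^1\to\mathbb{R}$ be a smooth and strictly positive function such that $$\int_0^{2\pi}\frac{g(\theta)+g''(\theta)}{u_0(\theta)}\sin(\theta)\,d\theta=\int_0^{2\pi}\frac{g(\theta)+g''(\theta)}{u_0(\theta)}\cos(\theta)\,d\theta=0.$$ Let $\mathcal{F}$ be the family of positive, nondecreasing and smooth functions $f:[0,\infty)\to\mathbb{R}$ with $f(0)=1$, and for $f\in\mathcal{F}$ consider the problem for $u=u(\theta,t)$ on $S^1$: $$u_t=\frac{g}{g+g''}u^2u_{\theta\theta}+\frac{2g'}{g+g''}u^2u_\theta+u^3+\frac{\dot f}{f}u,\qquad u(\cdot,0)=u_0.$$ Then there is a uniform upper bound for the blow-up time of the solutions to these problems which depends only on $g$ and $u_0$: there exists a time $T=T(u_0,g)$ such that, for every $f\in\mathcal{F}$ and every solution $u$ of the associated problem, $u$ or some of its derivatives blows up at some time $t\le T$. The time $T$ is explicitly given by $T=\dfrac{A}{2B}$, where $A$ is the area enclosed by the curve whose minkowskian curvature with respect to the norm given by the curve $\theta\mapsto g(\theta)e_r+g'(\theta)e_\theta$ is $u_0$, and $B$ is the area enclosed by the curve $\theta\mapsto g(\theta)e_r+g'(\theta)e_\theta$.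
   Context: $S^1=\mathbb{R}/2\pi\mathbb{Z}$, $e_r=(\cos\theta,\sin\theta)$, $e_\theta=(-\sin\theta,\cos\theta)$; primes denote derivatives in $\theta$ and $\dot f$ is the derivative of $f$. Solutions are understood to be continued for as long as they exist. When $g>0$, $g+g''>0$ and $g$ is $\pi$-periodic, the curve $p(\theta)=g(\theta)e_r+g'(\theta)e_\theta$ is the boundary of the unit ball of a norm on $\mathbb{R}^2$. A strictly convex closed curve $\gamma$ parameterized so that $\theta+\pi/2$ is the angle between $\gamma'(\theta)$ and the $x$-axis has minkowskian curvature $[p,p']/\lambda$ with respect to this norm, where $[\cdot,\cdot]$ is the determinant and $\gamma'(\theta)=\lambda(\theta)q(\theta)$ with $q=p'/[p,p']=e_\theta/g$. Thus the curve with minkowskian curvature $u_0$ is (up to translation) the closed curve with $\gamma'(\theta)=\dfrac{g(\theta)+g''(\theta)}{u_0(\theta)}e_\theta$. *)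

theory Defs
  imports "HOL-Analysis.Analysis"
begin

text \<open>Functions on \<open>S\<^sup>1 = \<real>/2\<pi>\<int>\<close> are represented by \<open>2\<pi>\<close>-periodic functions on \<^typ>\<open>real\<close>.\<close>

definition circle_fun :: "(real \<Rightarrow> 'a) \<Rightarrow> bool" where
  "circle_fun h \<longleftrightarrow> (\<forall>\<theta>. h (\<theta> + 2 * pi) = h \<theta>)"

text \<open>The derivative relative to a set: one-sided at an endpoint belonging to an interval \<open>S\<close>.\<close>

definition deriv_on :: "real set \<Rightarrow> (real \<Rightarrow> real) \<Rightarrow> real \<Rightarrow> real" where
  "deriv_on S h = (\<lambda>x. vector_derivative h (at x within S))"

definition smooth_on :: "real set \<Rightarrow> (real \<Rightarrow> real) \<Rightarrow> bool" where
  "smooth_on S h \<longleftrightarrow> (\<forall>n. \<forall>x\<in>S. (deriv_on S ^^ n) h differentiable (at x within S))"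


section \<open>Minkowskian geometry of the plane\<close>

definition e_r :: "real \<Rightarrow> real^2" where
  "e_r \<theta> = vector [cos \<theta>, sin \<theta>]"

definition e_theta :: "real \<Rightarrow> real^2" where
  "e_theta \<theta> = vector [- sin \<theta>, cos \<theta>]"

definition bracket :: "real^2 \<Rightarrow> real^2 \<Rightarrow> real" where
  "bracket v w = det (vector [v, w] :: real^2^2)"

definition p_curve :: "(real \<Rightarrow> real) \<Rightarrow> real \<Rightarrow> real^2" where
  "p_curve g \<theta> = g \<theta> *\<^sub>R e_r \<theta> + deriv g \<theta> *\<^sub>R e_theta \<theta>"

definition p_curve' :: "(real \<Rightarrow> real) \<Rightarrow> real \<Rightarrow> real^2" where
  "p_curve' g \<theta> = vector_derivative (p_curve g) (at \<theta>)"

definition q_curve :: "(real \<Rightarrow> real) \<Rightarrow> real \<Rightarrow> real^2" where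
  "q_curve g \<theta> = (1 / bracket (p_curve g \<theta>) (p_curve' g \<theta>)) *\<^sub>R p_curve' g \<theta>"

text \<open>
  The closed curve \<open>\<gamma>\<close> has minkowskian curvature \<open>k\<close> with respect to the norm whose unit circle
  is \<^term>\<open>p_curve g\<close>. As \<open>q_curve g \<theta>\<close> equals \<open>e_theta \<theta> / g \<theta>\<close> (for \<open>g > 0\<close>,
  \<open>g + g'' > 0\<close>), positivity of \<open>l\<close> says that \<open>\<theta> + \<pi>/2\<close> is the angle between \<open>\<gamma>'(\<theta>)\<close> and the \<open>x\<close>-axis; together with the
  \<open>2\<pi>\<close>-periodicity of \<open>\<gamma>\<close> this makes \<open>\<gamma>\<close> a simple, strictly convex closed curve.
\<close>

definition has_minkowskian_curvature ::
    "(real \<Rightarrow> real) \<Rightarrow> (real \<Rightarrow> real^2) \<Rightarrow> (real \<Rightarrow> real) \<Rightarrow> bool" where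
  "has_minkowskian_curvature g \<gamma> k \<longleftrightarrow>
     circle_fun \<gamma> \<and>
     (\<exists>l. \<forall>\<theta>. l \<theta> > 0 \<and>
        (\<gamma> has_vector_derivative l \<theta> *\<^sub>R q_curve g \<theta>) (at \<theta>) \<and>
        k \<theta> = bracket (p_curve g \<theta>) (p_curve' g \<theta>) / l \<theta>)"

definition enclosed_area :: "(real \<Rightarrow> real^2) \<Rightarrow> real" where
  "enclosed_area \<gamma> = measure lebesgue (inside (\<gamma> ` {0..2 * pi}))"


section \<open>The evolution problem\<close>

definition family_F :: "(real \<Rightarrow> real) set" where
  "family_F = {f. (\<forall>t\<ge>0. f t > 0) \<and> mono_on {0..} f \<and> smooth_on {0..} f \<and> f 0 = 1}"

text \<open>
  \<open>partial_deriv I i j u\<close> is the derivative of \<open>u(\<theta>,t)\<close> taken \<open>i\<close> times in \<open>\<theta>\<close> and \<open>j\<close> times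
  in \<open>t \<in> I\<close>. Smoothness on \<open>S\<^sup>1 \<times> I\<close> means that all of these exist, are compatible with one
  another, and are jointly continuous (up to those endpoints of \<open>I\<close> that belong to \<open>I\<close>).
\<close>

definition partial_deriv ::
    "real set \<Rightarrow> nat \<Rightarrow> nat \<Rightarrow> (real \<Rightarrow> real \<Rightarrow> real) \<Rightarrow> real \<Rightarrow> real \<Rightarrow> real" where
  "partial_deriv I i j u \<theta> t = (deriv ^^ i) (\<lambda>x. (deriv_on I ^^ j) (u x) t) \<theta>"

definition smooth_on_strip :: "real set \<Rightarrow> (real \<Rightarrow> real \<Rightarrow> real) \<Rightarrow> bool" where
  "smooth_on_strip I u \<longleftrightarrow>
     (\<forall>i j. continuous_on (UNIV \<times> I) (\<lambda>(\<theta>, t). partial_deriv I i j u \<theta> t) \<and>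
        (\<forall>\<theta>. \<forall>t\<in>I.
           ((\<lambda>x. partial_deriv I i j u x t) has_real_derivative
              partial_deriv I (Suc i) j u \<theta> t) (at \<theta>) \<and>
           ((\<lambda>s. partial_deriv I i j u \<theta> s) has_real_derivative
              partial_deriv I i (Suc j) u \<theta> t) (at t within I)))"

definition solution_on ::
    "(real \<Rightarrow> real) \<Rightarrow> (real \<Rightarrow> real) \<Rightarrow> (real \<Rightarrow> real) \<Rightarrow> real set \<Rightarrow> (real \<Rightarrow> real \<Rightarrow> real) \<Rightarrow> bool"
  where
  "solution_on g f u\<^sub>0 I u \<longleftrightarrow>
     is_interval I \<and> 0 \<in> I \<and> I \<subseteq> {0..} \<and> I \<noteq> {0} \<and>
     (\<forall>t\<in>I. circle_fun (\<lambda>\<theta>. u \<theta> t)) \<and>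
     smooth_on_strip I u \<and>
     (\<forall>\<theta>. u \<theta> 0 = u\<^sub>0 \<theta>) \<and>
     (\<forall>\<theta>. \<forall>t\<in>I.
        deriv_on I (u \<theta>) t =
          g \<theta> / (g \<theta> + deriv (deriv g) \<theta>) * (u \<theta> t)\<^sup>2 * deriv (deriv (\<lambda>x. u x t)) \<theta>
          + 2 * deriv g \<theta> / (g \<theta> + deriv (deriv g) \<theta>) * (u \<theta> t)\<^sup>2 * deriv (\<lambda>x. u x t) \<theta>
          + (u \<theta> t) ^ 3
          + deriv_on {0..} f t / f t * u \<theta> t)"

definition time_interval :: "ereal \<Rightarrow> real set" where
  "time_interval \<tau> = {t. 0 \<le> t \<and> ereal t < \<tau>}"

text \<open>
  A solution continued for as long as it exists, \<open>\<tau> \<in> (0,\<infinity>]\<close> being its lifespan: it is defined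
  on \<open>[0,\<tau>)\<close> and not the restriction of a solution on a larger time interval, closed or not.
\<close>

definition maximal_solution ::
    "(real \<Rightarrow> real) \<Rightarrow> (real \<Rightarrow> real) \<Rightarrow> (real \<Rightarrow> real) \<Rightarrow> ereal \<Rightarrow> (real \<Rightarrow> real \<Rightarrow> real) \<Rightarrow> bool"
  where
  "maximal_solution g f u\<^sub>0 \<tau> u \<longleftrightarrow>
     solution_on g f u\<^sub>0 (time_interval \<tau>) u \<and>
     \<not> (\<exists>J v. time_interval \<tau> \<subset> J \<and> solution_on g f u\<^sub>0 J v \<and>
          (\<forall>\<theta>. \<forall>t\<in>time_interval \<tau>. v \<theta> t = u \<theta> t))"

text \<open>\<open>u\<close>, given on \<open>S\<^sup>1 \<times> [0,t)\<close>, or some derivative of it is unbounded as time increases to \<open>t\<close>.\<close>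

definition blows_up_at :: "(real \<Rightarrow> real \<Rightarrow> real) \<Rightarrow> real \<Rightarrow> bool" where
  "blows_up_at u t \<longleftrightarrow>
     (\<exists>i j. \<forall>M. \<exists>\<^sub>F s in at_left t. \<exists>\<theta>. \<bar>partial_deriv {0..<t} i j u \<theta> s\<bar> > M)"

end

theory Submission
  imports Defs "HOL-Library.Periodic_Fun"
begin

text \<open>
  Write \<open>a = g + g''\<close>. A closed curve with \<open>\<gamma>' = \<rho> e_theta\<close> is convex, and by Green's formula it
  encloses the area \<open>A(\<rho>) = 1/2 \<integral> \<rho> h\<close>, where \<open>h(\<theta>) = (\<gamma>(\<theta>) - \<gamma>(0)) \<bullet> e_r(\<theta>)\<close>
  is the support function seen from the point \<open>\<gamma>(0)\<close> of the curve. The curve of minkowskian curvature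
  \<open>u\<^sub>0\<close> has \<open>\<rho> = a / u\<^sub>0\<close>, and the unit circle \<open>p\<close> has \<open>\<rho> = a\<close> and area \<open>B = 1/2 \<integral> g a\<close>.

  Rescale a solution to \<open>\<rho> = a f / u\<close>. The factor \<open>f\<close> absorbs the term with \<open>f'/f\<close>, and the equation
  becomes \<open>\<rho>\<^sub>t = - (w'' + w)\<close> with \<open>w = f g u\<close>: a family of curves whose support function
  moves inward with speed \<open>w\<close>. The kernel of \<open>w \<mapsto> w'' + w\<close> is spanned by \<open>cos\<close> and \<open>sin\<close>, so two
  integrations by parts show that \<open>\<integral> \<rho> cos = \<integral> \<rho> sin = 0\<close> persists (\<open>closure_flow\<close>), and
  symmetry of the area functional gives \<open>dA/dt = - \<integral> \<rho> w\<close> (\<open>curve_area_flow\<close>). Here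
  \<open>\<rho> w = f\<^sup>2 g a\<close>, so \<open>dA/dt = - 2 B f\<^sup>2 \<le> - 2 B\<close> because \<open>f \<ge> f(0) = 1\<close>. As the closed curve
  belonging to \<open>\<rho>\<close> encloses positive area at every time, a solution can only live on times
  \<open>t < A(0) / (2 B)\<close> (\<open>lifespan\<close>).

  A maximal solution on \<open>[0,\<tau>)\<close> must blow up at \<open>\<tau>\<close>: if all derivatives stayed bounded near \<open>\<tau>\<close>,
  they would all have limits there, and these limits would extend \<open>u\<close> to a smooth solution on the
  closed interval \<open>[0,\<tau>]\<close> (\<open>solution_extends\<close>). This contradicts maximality,
  which excludes extensions to closed intervals as well.

  What remains is the area formula for the set-theoretic inside of the curve. The curve is the frontier
  of the intersection of its supporting half-planes, and the interior of that convex set is swept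
  injectively by the chords from \<open>\<gamma>(0)\<close> to \<open>\<gamma>(\<theta>)\<close>, with Jacobian \<open>r \<rho> h\<close>; integrating the
  Jacobian yields the formula.
\<close>

section \<open>The area enclosed by a convex curve\<close>

lemma inner_real2: "(x::real^2) \<bullet> y = x $ 1 * y $ 1 + x $ 2 * y $ 2"
  by (simp add: inner_vec_def sum_2)

lemma e_r_nth [simp]: "e_r \<theta> $ 1 = cos \<theta>" "e_r \<theta> $ 2 = sin \<theta>"
  by (simp_all add: e_r_def)

lemma e_theta_nth [simp]: "e_theta \<theta> $ 1 = - sin \<theta>" "e_theta \<theta> $ 2 = cos \<theta>"
  by (simp_all add: e_theta_def)

lemma vec2_eqI: "x $ 1 = y $ 1 \<Longrightarrow> x $ 2 = y $ 2 \<Longrightarrow> x = (y::real^2)"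
  by (simp add: vec_eq_iff forall_2)

lemma inner_e_theta_e_r: "e_theta \<phi> \<bullet> e_r \<theta> = sin (\<theta> - \<phi>)"
  by (simp add: inner_real2 sin_diff mult.commute)

lemma norm_e_r [simp]: "norm (e_r \<theta>) = 1"
  by (simp add: norm_eq_sqrt_inner inner_real2 flip: power2_eq_square)

lemma inner_e_r_self [simp]: "e_r \<theta> \<bullet> e_r \<theta> = 1"
  by (simp add: inner_real2 flip: power2_eq_square)

lemma frame_eq_0:
  assumes "v \<bullet> e_r \<theta> = 0" "v \<bullet> e_theta \<theta> = 0"
  shows "v = 0"
proof -
  have 1: "v $ 1 * cos \<theta> + v $ 2 * sin \<theta> = 0" "v $ 2 * cos \<theta> - v $ 1 * sin \<theta> = 0"
    using assms by (simp_all add: inner_real2)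
  have s: "(cos \<theta>)\<^sup>2 + (sin \<theta>)\<^sup>2 = 1" by simp
  have "v $ 1 * ((cos \<theta>)\<^sup>2 + (sin \<theta>)\<^sup>2) = 0" "v $ 2 * ((cos \<theta>)\<^sup>2 + (sin \<theta>)\<^sup>2) = 0"
    using 1 by algebra+
  then show ?thesis using s by (simp add: vec2_eqI)
qed

lemma e_r_has_vector_derivative:
  "(e_r has_vector_derivative e_theta \<theta>) (at \<theta>)"
proof -
  have eq: "e_r = (\<lambda>\<theta>. cos \<theta> *\<^sub>R vector [1, 0] + sin \<theta> *\<^sub>R vector [0, 1])"
    by (intro ext vec2_eqI) simp_all
  have eq': "e_theta \<theta> = (- sin \<theta>) *\<^sub>R vector [1, 0] + cos \<theta> *\<^sub>R vector [0, 1]"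
    by (intro vec2_eqI) simp_all
  show ?thesis unfolding eq eq'
    by (auto intro!: derivative_eq_intros)
qed

lemma e_theta_has_vector_derivative:
  "(e_theta has_vector_derivative - e_r \<theta>) (at \<theta>)"
proof -
  have eq: "e_theta = (\<lambda>\<theta>. (- sin \<theta>) *\<^sub>R vector [1, 0] + cos \<theta> *\<^sub>R vector [0, 1])"
    by (intro ext vec2_eqI) simp_all
  have eq': "- e_r \<theta> = (- cos \<theta>) *\<^sub>R vector [1, 0] + (- sin \<theta>) *\<^sub>R vector [0, 1]"
    by (intro vec2_eqI) simp_all
  show ?thesis unfolding eq eq'
    by (auto intro!: derivative_eq_intros)
qed

lemma continuous_on_e_r [continuous_intros]: "continuous_on S e_r"
  by (meson continuous_at_imp_continuous_on has_vector_derivative_continuous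
      e_r_has_vector_derivative)

lemma continuous_on_e_theta [continuous_intros]: "continuous_on S e_theta"
  by (meson continuous_at_imp_continuous_on has_vector_derivative_continuous
      e_theta_has_vector_derivative)

lemma periodic_reduce:
  fixes \<theta> a :: real
  obtains k :: int where "a \<le> \<theta> + of_int k * (2 * pi)" "\<theta> + of_int k * (2 * pi) < a + 2 * pi"
proof
  define k where "k = - \<lfloor>(\<theta> - a) / (2 * pi)\<rfloor>"
  have "of_int \<lfloor>(\<theta> - a) / (2 * pi)\<rfloor> * (2 * pi) \<le> \<theta> - a"
    using floor_divide_lower[of "2 * pi" "\<theta> - a"] by simp
  moreover have "\<theta> - a < (of_int \<lfloor>(\<theta> - a) / (2 * pi)\<rfloor> + 1) * (2 * pi)"
    using floor_divide_upper[of "2 * pi" "\<theta> - a"] by simp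
  ultimately show "a \<le> \<theta> + of_int k * (2 * pi)" "\<theta> + of_int k * (2 * pi) < a + 2 * pi"
    by (simp_all add: k_def algebra_simps)
qed

lemma circle_fun_of_int:
  assumes "circle_fun h"
  shows "h (\<theta> + of_int k * (2 * pi)) = h \<theta>"
proof -
  interpret periodic_fun_simple h "2 * pi"
    by standard (use assms in \<open>simp add: circle_fun_def\<close>)
  show ?thesis by (rule plus_of_int)
qed

lemma circle_fun_e_r: "circle_fun e_r"
  by (simp add: circle_fun_def e_r_def)

text \<open>
  The change of variables theorem lives on \<^typ>\<open>real^2\<close> while iterated integration lives on
  \<^typ>\<open>real \<times> real\<close>; the obvious measure-preserving identification links the two.
\<close>

lemma has_integral_cart2:
  fixes a b :: "real^2"
  assumes "(f has_integral i) (cbox (a $ 1, a $ 2) (b $ 1, b $ 2))"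
  shows "((\<lambda>v. f (v $ 1, v $ 2)) has_integral i) (cbox a b)"
proof -
  let ?g = "\<lambda>v::real^2. (v $ 1, v $ 2)" and ?h = "\<lambda>(x, y). vector [x, y] :: real^2"
  have g: "?g ` cbox u v = cbox (u $ 1, u $ 2) (v $ 1, v $ 2)" for u v
  proof (intro subset_antisym subsetI)
    fix p assume p: "p \<in> cbox (u $ 1, u $ 2) (v $ 1, v $ 2)"
    then have "?h p \<in> cbox u v" by (auto simp: mem_box_cart forall_2 cbox_Pair_eq)
    moreover have "p = ?g (?h p)" by (cases p) simp
    ultimately show "p \<in> ?g ` cbox u v" by blast
  qed (auto simp: mem_box_cart cbox_Pair_eq)
  have h: "?h ` cbox u v = cbox (?h u) (?h v)" for u v
  proof -
    have "cbox u v = ?g ` cbox (?h u) (?h v)"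
      unfolding g by (simp add: split_beta)
    moreover have "vector [x $ 1, x $ 2] = x" for x :: "real^2" by (simp add: vec2_eqI)
    ultimately show ?thesis by (simp add: image_image)
  qed
  have c: "measure lborel (?g ` cbox u v) = 1 * measure lborel (cbox u v)" for u v
  proof -
    have "cbox u v = {} \<longleftrightarrow> cbox (u $ 1, u $ 2) (v $ 1, v $ 2) = {}"
      unfolding g[symmetric] by auto
    then show ?thesis
      unfolding g content_Pair
      by (auto simp: content_cbox_if_cart content_real_if UNIV_2 cbox_Pair_eq)
  qed
  have "((\<lambda>v. f (?g v)) has_integral (1 / 1) *\<^sub>R i) (?h ` cbox (a $ 1, a $ 2) (b $ 1, b $ 2))"
  proof (rule has_integral_twiddle[where g = ?g and h = ?h])
    show "?h (?g x) = x" for x by (auto intro!: vec2_eqI)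
    show "?g (?h x) = x" for x by (cases x) simp
    show "continuous (at x) ?g" for x by (intro continuous_intros)
    show "\<exists>w z. ?g ` cbox u v = cbox w z" for u v using g by blast
    show "\<exists>w z. ?h ` cbox u v = cbox w z" for u v using h by blast
  qed (use assms c in auto)
  moreover have "?h (u $ 1, u $ 2) = u" for u by (auto intro!: vec2_eqI)
  ultimately show ?thesis by (simp add: h)
qed

text \<open>
  The angle \<open>\<theta>\<close> is the direction of the outer normal \<^term>\<open>e_r \<theta>\<close>, and \<open>\<rho>\<close> is the
  euclidean radius of curvature. Closedness forces \<open>\<rho>\<close> to be orthogonal to \<open>cos\<close> and \<open>sin\<close>,
  and its positivity makes the curve strictly convex.
\<close>

locale convex_curve =
  fixes \<gamma> :: "real \<Rightarrow> real^2" and \<rho> :: "real \<Rightarrow> real"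
  assumes closed_curve: "circle_fun \<gamma>"
    and tangent: "\<And>\<theta>. (\<gamma> has_vector_derivative \<rho> \<theta> *\<^sub>R e_theta \<theta>) (at \<theta>)"
    and speed_pos: "\<And>\<theta>. \<rho> \<theta> > 0"
    and speed_continuous: "continuous_on UNIV \<rho>"
begin

lemma continuous_curve [continuous_intros]: "continuous_on S \<gamma>"
  by (meson continuous_at_imp_continuous_on has_vector_derivative_continuous tangent)

lemma endpoints: "\<gamma> (2 * pi) = \<gamma> 0"
  using closed_curve by (metis circle_fun_def add_0)

lemma inner_derivative:
  "((\<lambda>\<phi>. (\<gamma> \<phi> - c) \<bullet> e_r \<theta>) has_real_derivative \<rho> \<phi> * sin (\<theta> - \<phi>)) (at \<phi>)"
proof -
  have "((\<lambda>\<phi>. \<gamma> \<phi> - c) has_vector_derivative \<rho> \<phi> *\<^sub>R e_theta \<phi>) (at \<phi>)"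
    using has_vector_derivative_diff[OF tangent has_vector_derivative_const[of c]] by simp
  from bounded_linear.has_vector_derivative[OF bounded_linear_inner_left this, of "e_r \<theta>"]
  show ?thesis
    by (simp add: has_real_derivative_iff_has_vector_derivative inner_e_theta_e_r)
qed

text \<open>
  Moving along the curve from \<open>\<gamma> \<theta>\<close>, the height in the normal direction \<^term>\<open>e_r \<theta>\<close> changes
  at the rate \<open>\<rho> \<phi> sin (\<theta> - \<phi>)\<close>: it falls for half a turn, rises for the other half, and is
  back at its initial value after a full turn. In between it stays below that value.
\<close>

lemma strictly_supported:
  assumes "\<theta> < \<phi>" "\<phi> < \<theta> + 2 * pi"
  shows "(\<gamma> \<phi> - \<gamma> \<theta>) \<bullet> e_r \<theta> < 0"
proof (cases "\<phi> \<le> \<theta> + pi")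
  case True
  have "(\<gamma> \<theta> - \<gamma> \<theta>) \<bullet> e_r \<theta> > (\<gamma> \<phi> - \<gamma> \<theta>) \<bullet> e_r \<theta>"
  proof (rule DERIV_neg_imp_decreasing_open[OF assms(1)])
    fix x assume x: "\<theta> < x" "x < \<phi>"
    have "sin (\<theta> - x) < 0" 
      using sin_gt_zero[of "x - \<theta>"] x True sin_minus[of "x - \<theta>"] by simp
    then have "\<rho> x * sin (\<theta> - x) < 0"
      using speed_pos[of x] by (simp add: mult_pos_neg)
    then show "\<exists>y. ((\<lambda>\<phi>. (\<gamma> \<phi> - \<gamma> \<theta>) \<bullet> e_r \<theta>) has_real_derivative y) (at x) \<and> y < 0"
      using inner_derivative by blast
  qed (intro continuous_intros)
  then show ?thesis by simp
next
  case False
  have "(\<gamma> \<phi> - \<gamma> \<theta>) \<bullet> e_r \<theta> < (\<gamma> (\<theta> + 2 * pi) - \<gamma> \<theta>) \<bullet> e_r \<theta>"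
  proof (rule DERIV_pos_imp_increasing_open[OF assms(2)])
    fix x assume x: "\<phi> < x" "x < \<theta> + 2 * pi"
    have "sin (\<theta> - x) > 0" 
      using sin_lt_zero[of "x - \<theta>"] x False sin_minus[of "x - \<theta>"] by simp
    then have "\<rho> x * sin (\<theta> - x) > 0"
      using speed_pos[of x] by simp
    then show "\<exists>y. ((\<lambda>\<phi>. (\<gamma> \<phi> - \<gamma> \<theta>) \<bullet> e_r \<theta>) has_real_derivative y) (at x) \<and> y > 0"
      using inner_derivative by blast
  qed (intro continuous_intros)
  then show ?thesis using closed_curve by (simp add: circle_fun_def)
qed

lemma supported_cases: "\<gamma> \<phi> = \<gamma> \<theta> \<or> (\<gamma> \<phi> - \<gamma> \<theta>) \<bullet> e_r \<theta> < 0"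
proof -
  obtain k :: int where k: "\<theta> \<le> \<phi> + of_int k * (2 * pi)" "\<phi> + of_int k * (2 * pi) < \<theta> + 2 * pi"
    by (rule periodic_reduce)
  have "\<gamma> (\<phi> + of_int k * (2 * pi)) = \<gamma> \<phi>"
    by (rule circle_fun_of_int[OF closed_curve])
  with k strictly_supported[of \<theta> "\<phi> + of_int k * (2 * pi)"] show ?thesis
    by (cases "\<theta> = \<phi> + of_int k * (2 * pi)") auto
qed

lemma supported: "(\<gamma> \<phi> - \<gamma> \<theta>) \<bullet> e_r \<theta> \<le> 0"
  using supported_cases[of \<phi> \<theta>] by auto

text \<open>
  The support function with respect to the point \<open>\<gamma> 0\<close> of the curve; its positivity is what makes
  both the Jacobian of the sweep and the enclosed area positive.
\<close>

lemma height_pos: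
  assumes "0 < \<theta>" "\<theta> < 2 * pi"
  shows "(\<gamma> \<theta> - \<gamma> 0) \<bullet> e_r \<theta> > 0"
proof -
  have "(\<gamma> (2 * pi) - \<gamma> \<theta>) \<bullet> e_r \<theta> < 0"
    using assms by (intro strictly_supported) auto
  then show ?thesis by (simp add: endpoints inner_diff_left)
qed

lemma curve_inj:
  assumes "\<gamma> \<theta> = \<gamma> \<phi>" "0 < \<theta>" "\<theta> < 2 * pi" "0 < \<phi>" "\<phi> < 2 * pi"
  shows "\<theta> = \<phi>"
  using strictly_supported[of \<theta> \<phi>] strictly_supported[of \<phi> \<theta>] assms
  by (cases \<theta> \<phi> rule: linorder_cases) auto

text \<open>
  The intersection of the supporting half-planes. Describing the region through its supporting
  lines makes convexity immediate and reduces all incidence questions to \<open>strictly_supported\<close>.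
\<close>

definition "body = {x. \<forall>\<theta>. (x - \<gamma> \<theta>) \<bullet> e_r \<theta> \<le> 0}"

definition "open_body = {x. \<forall>\<theta>. (x - \<gamma> \<theta>) \<bullet> e_r \<theta> < 0}"

lemma body_halfspaces: "body = (\<Inter>\<theta>. {x. e_r \<theta> \<bullet> x \<le> e_r \<theta> \<bullet> \<gamma> \<theta>})"
  by (simp add: body_def set_eq_iff inner_diff_left inner_commute[of "e_r _"])

lemma convex_body: "convex body"
  unfolding body_halfspaces by (intro convex_INT convex_halfspace_le)

lemma closed_body: "closed body"
  unfolding body_halfspaces by (intro closed_INT ballI closed_halfspace_le)

lemma bounded_body: "bounded body"
proof -
  have "norm x \<le> (\<bar>\<gamma> 0 $ 1\<bar> + \<bar>\<gamma> pi $ 1\<bar>) + (\<bar>\<gamma> (pi/2) $ 2\<bar> + \<bar>\<gamma> (- (pi/2)) $ 2\<bar>)"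
    if "x \<in> body" for x
  proof -
    have "(x - \<gamma> \<theta>) \<bullet> e_r \<theta> \<le> 0" for \<theta> using that by (simp add: body_def)
    from this[of 0] this[of pi] this[of "pi/2"] this[of "- (pi/2)"]
    have "\<bar>x $ 1\<bar> \<le> \<bar>\<gamma> 0 $ 1\<bar> + \<bar>\<gamma> pi $ 1\<bar>" "\<bar>x $ 2\<bar> \<le> \<bar>\<gamma> (pi/2) $ 2\<bar> + \<bar>\<gamma> (- (pi/2)) $ 2\<bar>"
      by (simp_all add: inner_real2)
    then show ?thesis
      using norm_le_l1_cart[of x] by (simp add: sum_2)
  qed
  then show ?thesis unfolding bounded_iff by blast
qed

lemma reduce_angle: "\<exists>\<theta>'\<in>{0..2 * pi}. \<gamma> \<theta>' = \<gamma> \<theta> \<and> e_r \<theta>' = e_r \<theta>"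
proof -
  obtain k :: int where "0 \<le> \<theta> + of_int k * (2 * pi)" "\<theta> + of_int k * (2 * pi) < 0 + 2 * pi"
    by (rule periodic_reduce)
  then show ?thesis
    using circle_fun_of_int[OF closed_curve] circle_fun_of_int[OF circle_fun_e_r]
    by (intro bexI[of _ "\<theta> + of_int k * (2 * pi)"]) auto
qed

text \<open>
  A strict inequality for every normal direction is uniform, since the directions form a compact
  set, and therefore survives small perturbations of the point.
\<close>

lemma interior_body: "interior body = open_body"
proof (intro subset_antisym subsetI)
  fix x assume "x \<in> interior body"
  then obtain \<epsilon> where \<epsilon>: "\<epsilon> > 0" "cball x \<epsilon> \<subseteq> body" by (auto simp: mem_interior_cball)
  have "(x - \<gamma> \<theta>) \<bullet> e_r \<theta> < 0" for \<theta>
  proof -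
    have "x + \<epsilon> *\<^sub>R e_r \<theta> \<in> body" using \<epsilon> by (intro subsetD[OF \<epsilon>(2)]) (simp add: dist_norm)
    then have "(x + \<epsilon> *\<^sub>R e_r \<theta> - \<gamma> \<theta>) \<bullet> e_r \<theta> \<le> 0" by (simp add: body_def)
    then show ?thesis using \<epsilon>(1) by (simp add: inner_add_left inner_diff_left)
  qed
  then show "x \<in> open_body" by (simp add: open_body_def)
next
  fix x assume x: "x \<in> open_body"
  have "continuous_on {0..2 * pi} (\<lambda>\<theta>. (x - \<gamma> \<theta>) \<bullet> e_r \<theta>)"
    by (intro continuous_intros)
  then obtain \<theta>\<^sub>0 where \<theta>\<^sub>0: "\<forall>\<theta>\<in>{0..2 * pi}. (x - \<gamma> \<theta>) \<bullet> e_r \<theta> \<le> (x - \<gamma> \<theta>\<^sub>0) \<bullet> e_r \<theta>\<^sub>0"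
    using continuous_attains_sup[of "{0..2 * pi}" "\<lambda>\<theta>. (x - \<gamma> \<theta>) \<bullet> e_r \<theta>"] by auto
  define \<delta> where "\<delta> = - ((x - \<gamma> \<theta>\<^sub>0) \<bullet> e_r \<theta>\<^sub>0)"
  have \<delta>: "\<delta> > 0" using x by (simp add: \<delta>_def open_body_def)
  have "ball x \<delta> \<subseteq> body"
  proof
    fix y assume y: "y \<in> ball x \<delta>"
    have "(y - \<gamma> \<theta>) \<bullet> e_r \<theta> \<le> 0" for \<theta>
    proof -
      obtain \<theta>' where \<theta>': "\<theta>' \<in> {0..2 * pi}" "\<gamma> \<theta>' = \<gamma> \<theta>" "e_r \<theta>' = e_r \<theta>"
        using reduce_angle by blast
      have "(y - x) \<bullet> e_r \<theta> \<le> norm (y - x)"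
        using norm_cauchy_schwarz[of "y - x" "e_r \<theta>"] by simp
      also have "\<dots> < \<delta>" using y by (simp add: dist_norm norm_minus_commute)
      finally show ?thesis using \<theta>\<^sub>0 \<theta>' by (force simp: \<delta>_def inner_diff_left)
    qed
    then show "y \<in> body" by (simp add: body_def)
  qed
  then show "x \<in> interior body" using \<delta> by (auto simp: mem_interior)
qed

text \<open>
  At a frontier point \<open>x\<close> some supporting inequality is an equality, say for \<open>\<theta>\<close>. Then \<open>\<theta>\<close>
  maximizes \<open>\<phi> \<mapsto> (x - \<gamma> \<phi>) \<bullet> e_r \<phi>\<close>, whose derivative is \<open>(x - \<gamma> \<phi>) \<bullet> e_theta \<phi>\<close>
  because \<open>\<gamma>'\<close> is orthogonal to \<open>e_r\<close>. So \<open>x - \<gamma> \<theta>\<close> is orthogonal to both vectors of the frame.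
\<close>

lemma frontier_body: "frontier body = range \<gamma>"
proof -
  have "frontier body = body - open_body"
    by (simp add: frontier_def interior_body closed_body)
  also have "\<dots> = range \<gamma>"
  proof (intro subset_antisym subsetI)
    fix x assume x: "x \<in> body - open_body"
    then obtain \<theta> where \<theta>: "(x - \<gamma> \<theta>) \<bullet> e_r \<theta> = 0"
      by (auto simp: body_def open_body_def) (metis order_antisym_conv leI)
    have "((\<lambda>\<phi>. x - \<gamma> \<phi>) has_vector_derivative - (\<rho> \<theta> *\<^sub>R e_theta \<theta>)) (at \<theta>)"
      using has_vector_derivative_diff[OF has_vector_derivative_const[of x] tangent] by simp
    from bounded_bilinear.has_vector_derivative[OF bounded_bilinear_inner this
        e_r_has_vector_derivative]
    have "((\<lambda>\<phi>. (x - \<gamma> \<phi>) \<bullet> e_r \<phi>) has_real_derivative (x - \<gamma> \<theta>) \<bullet> e_theta \<theta>) (at \<theta>)"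
      by (simp add: has_real_derivative_iff_has_vector_derivative inner_e_theta_e_r)
    moreover have "\<forall>\<phi>. \<bar>\<theta> - \<phi>\<bar> < 1 \<longrightarrow> (x - \<gamma> \<phi>) \<bullet> e_r \<phi> \<le> (x - \<gamma> \<theta>) \<bullet> e_r \<theta>"
      using x \<theta> by (simp add: body_def)
    ultimately have "(x - \<gamma> \<theta>) \<bullet> e_theta \<theta> = 0"
      using DERIV_local_max zero_less_one by blast
    with \<theta> have "x - \<gamma> \<theta> = 0" by (intro frame_eq_0)
    then show "x \<in> range \<gamma>" by simp
  next
    fix x assume "x \<in> range \<gamma>"
    then obtain \<phi> where x: "x = \<gamma> \<phi>" by auto
    then have "x \<in> body" by (simp add: body_def supported)
    moreover have "x \<notin> open_body" by (auto simp: x open_body_def intro: exI[of _ \<phi>])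
    ultimately show "x \<in> body - open_body" by simp
  qed
  finally show ?thesis .
qed

lemma image_period: "\<gamma> ` {0..2 * pi} = range \<gamma>"
proof (intro subset_antisym subsetI)
  fix x assume "x \<in> range \<gamma>"
  then obtain \<theta> where "x = \<gamma> \<theta>" by auto
  with reduce_angle[of \<theta>] show "x \<in> \<gamma> ` {0..2 * pi}" by (metis imageI)
qed auto

lemma inside_curve: "inside (\<gamma> ` {0..2 * pi}) = open_body"
  unfolding image_period frontier_body[symmetric]
  by (simp add: inside_frontier_eq_interior bounded_body convex_body interior_body)

text \<open>
  The chords are drawn from a point of the curve itself, not from an interior point. Thus the
  rectangle covers the open region exactly, with no slit or centre to be treated separately.
\<close>

definition "sweep v = \<gamma> 0 + (v $ 1) *\<^sub>R (\<gamma> (v $ 2) - \<gamma> 0)" for v :: "real^2"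

definition "sweep_box = box 0 (vector [1, 2 * pi] :: real^2)"

lemma mem_sweep_box: "v \<in> sweep_box \<longleftrightarrow> 0 < v $ 1 \<and> v $ 1 < 1 \<and> 0 < v $ 2 \<and> v $ 2 < 2 * pi"
  by (auto simp: sweep_box_def mem_box_cart forall_2)

lemma sweep_mem_open_body:
  assumes r: "0 < r" "r < 1" and \<theta>: "0 < \<theta>" "\<theta> < 2 * pi"
  shows "\<gamma> 0 + r *\<^sub>R (\<gamma> \<theta> - \<gamma> 0) \<in> open_body"
  unfolding open_body_def
proof clarify
  fix \<phi>
  have eq: "(\<gamma> 0 + r *\<^sub>R (\<gamma> \<theta> - \<gamma> 0) - \<gamma> \<phi>) \<bullet> e_r \<phi>
      = (1 - r) * ((\<gamma> 0 - \<gamma> \<phi>) \<bullet> e_r \<phi>) + r * ((\<gamma> \<theta> - \<gamma> \<phi>) \<bullet> e_r \<phi>)"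
    by (simp add: inner_add_left inner_diff_left algebra_simps)
  have "\<gamma> 0 \<noteq> \<gamma> \<theta>" using height_pos[OF \<theta>] by auto
  then have "(\<gamma> 0 - \<gamma> \<phi>) \<bullet> e_r \<phi> < 0 \<or> (\<gamma> \<theta> - \<gamma> \<phi>) \<bullet> e_r \<phi> < 0"
    using supported_cases by metis
  then show "(\<gamma> 0 + r *\<^sub>R (\<gamma> \<theta> - \<gamma> 0) - \<gamma> \<phi>) \<bullet> e_r \<phi> < 0"
    unfolding eq using r supported[of 0 \<phi>] supported[of \<theta> \<phi>]
    by (smt (verit, best) mult_nonneg_nonpos mult_pos_neg)
qed

lemma curve_not_open_body: "\<gamma> \<theta> \<notin> open_body"
  by (auto simp: open_body_def intro: exI[of _ \<theta>])

text \<open>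
  The ray from \<open>\<gamma> 0\<close> through an interior point \<open>x\<close> leaves the bounded region at some \<open>\<gamma> \<theta>\<close>
  behind \<open>x\<close>, so that \<open>x\<close> lies on the chord to \<open>\<gamma> \<theta>\<close>.
\<close>

lemma sweep_image: "sweep ` sweep_box = open_body"
proof (intro subset_antisym subsetI)
  fix x assume "x \<in> sweep ` sweep_box"
  then show "x \<in> open_body"
    by (auto simp: mem_sweep_box sweep_def sweep_mem_open_body)
next
  fix x assume x: "x \<in> open_body"
  then have ne: "x - \<gamma> 0 \<noteq> 0" using curve_not_open_body by auto
  obtain d where d: "0 < d" "x + d *\<^sub>R (x - \<gamma> 0) \<in> frontier body"
    using ray_to_frontier[OF bounded_body _ ne] x by (metis interior_body)
  then obtain \<theta> where \<theta>: "\<theta> \<in> {0..2 * pi}" "\<gamma> \<theta> = x + d *\<^sub>R (x - \<gamma> 0)"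
    unfolding frontier_body image_period[symmetric] by auto
  have 1: "\<gamma> \<theta> - \<gamma> 0 = (1 + d) *\<^sub>R (x - \<gamma> 0)" using \<theta> by (simp add: algebra_simps)
  have "\<theta> \<noteq> 0" "\<theta> \<noteq> 2 * pi" using 1 ne d(1) endpoints by auto
  then have "vector [1 / (1 + d), \<theta>] \<in> sweep_box"
    using \<theta>(1) d(1) by (auto simp: mem_sweep_box)
  moreover have "x = sweep (vector [1 / (1 + d), \<theta>])"
    using d(1) by (simp add: sweep_def 1)
  ultimately show "x \<in> sweep ` sweep_box" by blast
qed

text \<open>
  If two chords shared a point at different fractions of their lengths, then the end point of the
  shorter one would lie in the open region; but it is on the curve.
\<close>

lemma sweep_inj: "inj_on sweep sweep_box"
proof -
  have *: "r' \<le> r" if r: "0 < r" "r < 1" "0 < r'" "r' < 1" and \<theta>: "0 < \<theta>" "\<theta> < 2 * pi"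
      and eq: "r *\<^sub>R (\<gamma> \<theta> - \<gamma> 0) = r' *\<^sub>R (\<gamma> \<phi> - \<gamma> 0)" for r r' \<theta> \<phi>
  proof (rule ccontr)
    assume "\<not> r' \<le> r"
    then have "\<gamma> 0 + (r / r') *\<^sub>R (\<gamma> \<theta> - \<gamma> 0) \<in> open_body"
      using r \<theta> by (intro sweep_mem_open_body) auto
    moreover have "(r / r') *\<^sub>R (\<gamma> \<theta> - \<gamma> 0) = (1 / r') *\<^sub>R (r *\<^sub>R (\<gamma> \<theta> - \<gamma> 0))" by simp
    then have "(r / r') *\<^sub>R (\<gamma> \<theta> - \<gamma> 0) = \<gamma> \<phi> - \<gamma> 0" using r by (simp add: eq)
    ultimately show False using curve_not_open_body[of \<phi>] by simp
  qed
  show ?thesis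
  proof (rule inj_onI)
    fix v w assume vw: "v \<in> sweep_box" "w \<in> sweep_box" "sweep v = sweep w"
    then have "v $ 1 = w $ 1"
      using *[of "v $ 1" "w $ 1" "v $ 2" "w $ 2"] *[of "w $ 1" "v $ 1" "w $ 2" "v $ 2"]
      by (force simp: mem_sweep_box sweep_def)
    moreover from this have "v $ 2 = w $ 2"
      using vw by (intro curve_inj) (auto simp: mem_sweep_box sweep_def)
    ultimately show "v = w" by (rule vec2_eqI)
  qed
qed

definition "sweep' v h = (h $ 1) *\<^sub>R (\<gamma> (v $ 2) - \<gamma> 0)
    + (v $ 1 * h $ 2 * \<rho> (v $ 2)) *\<^sub>R e_theta (v $ 2)" for v h :: "real^2"

lemma sweep_has_derivative: "(sweep has_derivative sweep' v) (at v)"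
proof -
  have "(\<gamma> has_derivative (\<lambda>x. x *\<^sub>R (\<rho> (v $ 2) *\<^sub>R e_theta (v $ 2)))) (at (v $ 2))"
    using tangent by (simp add: has_vector_derivative_def)
  from has_derivative_compose[where f = "\<lambda>v::real^2. v $ 2" and f' = "\<lambda>h. h $ 2", OF _ this]
  have d: "((\<lambda>w. \<gamma> (w $ 2)) has_derivative
      (\<lambda>h. (h $ 2) *\<^sub>R (\<rho> (v $ 2) *\<^sub>R e_theta (v $ 2)))) (at v)"
    by (simp add: bounded_linear_imp_has_derivative bounded_linear_vec_nth)
  have d1: "((\<lambda>w::real^2. w $ 1) has_derivative (\<lambda>h. h $ 1)) (at v)"
    by (simp add: bounded_linear_imp_has_derivative bounded_linear_vec_nth)
  show ?thesis
    unfolding sweep_def[abs_def] sweep'_def[abs_def]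
    by (rule has_derivative_eq_rhs, (rule derivative_intros d d1)+) (simp add: algebra_simps)
qed

lemma det_sweep':
  "det (matrix (sweep' v)) = v $ 1 * (\<rho> (v $ 2) * ((\<gamma> (v $ 2) - \<gamma> 0) \<bullet> e_r (v $ 2)))"
  by (simp add: det_2 matrix_def sweep'_def axis_def inner_real2 algebra_simps)


text \<open>
  The Jacobian \<open>r \<rho> h\<close> of the sweep separates the variables, and the factor \<open>1/2\<close> is the
  integral of \<open>r\<close> over the unit interval.
\<close>

theorem enclosed_area_curve:
  "enclosed_area \<gamma> = 1/2 * integral {0..2 * pi} (\<lambda>\<theta>. \<rho> \<theta> * ((\<gamma> \<theta> - \<gamma> 0) \<bullet> e_r \<theta>))"
proof -
  define \<phi> where "\<phi> \<theta> = \<rho> \<theta> * ((\<gamma> \<theta> - \<gamma> 0) \<bullet> e_r \<theta>)" for \<theta>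
  have \<phi>: "continuous_on S \<phi>" for S
    unfolding \<phi>_def
    by (intro continuous_intros continuous_on_subset[OF speed_continuous]) auto
  let ?f = "\<lambda>p::real\<times>real. fst p * \<phi> (snd p)"
  have f: "continuous_on S ?f" for S
    by (intro continuous_intros continuous_on_compose2[OF \<phi>[of UNIV]]) auto
  have "integral (cbox (0, 0) (1, 2 * pi)) ?f
      = integral (cbox 0 1) (\<lambda>x. integral (cbox 0 (2 * pi)) (\<lambda>y. ?f (x, y)))"
    by (rule integral_prod_continuous[OF f])
  also have "\<dots> = integral {0..1} (\<lambda>x. x * integral {0..2 * pi} \<phi>)"
    by simp
  also have "\<dots> = integral {0..1} (\<lambda>x. x) * integral {0..2 * pi} \<phi>"
    by simp
  also have "integral {0..1} (\<lambda>x. x) = (1/2 :: real)"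
    using ident_has_integral[of 0 1] by (simp add: integral_unique)
  finally have "(?f has_integral 1/2 * integral {0..2 * pi} \<phi>) (cbox (0, 0) (1, 2 * pi))"
    using integrable_continuous[OF f] by (metis integrable_integral)
  then have "((\<lambda>v::real^2. v $ 1 * \<phi> (v $ 2)) has_integral 1/2 * integral {0..2 * pi} \<phi>)
      (cbox 0 (vector [1, 2 * pi]))"
    by (intro has_integral_cart2[where f = ?f, simplified]) simp_all
  then have "((\<lambda>v. v $ 1 * \<phi> (v $ 2)) has_integral 1/2 * integral {0..2 * pi} \<phi>) sweep_box"
    by (simp add: sweep_box_def has_integral_open_interval)
  moreover have "\<bar>det (matrix (sweep' v))\<bar> = v $ 1 * \<phi> (v $ 2)" if "v \<in> sweep_box" for v
    using that height_pos[of "v $ 2"] speed_pos[of "v $ 2"]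
    by (simp add: det_sweep' \<phi>_def mem_sweep_box abs_mult)
  ultimately have "((\<lambda>v. \<bar>det (matrix (sweep' v))\<bar>) has_integral 1/2 * integral {0..2 * pi} \<phi>) sweep_box"
    by (subst has_integral_cong) auto
  then have "measure lebesgue (sweep ` sweep_box) = 1/2 * integral {0..2 * pi} \<phi>"
    using has_measure_differentiable_image[of sweep_box sweep sweep' "1/2 * integral {0..2 * pi} \<phi>"]
      sweep_has_derivative sweep_inj
    by (auto simp: sweep_box_def has_derivative_at_withinI)
  then show ?thesis
    by (simp add: enclosed_area_def inside_curve sweep_image \<phi>_def[abs_def])
qed

end


section \<open>The area functional and its evolution\<close>

lemma has_integral_derivative:
  fixes F f :: "real \<Rightarrow> real"
  assumes "\<And>x. (F has_real_derivative f x) (at x)" "a \<le> b"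
  shows "(f has_integral F b - F a) {a..b}"
  using assms(2)
proof (rule fundamental_theorem_of_calculus)
  show "(F has_vector_derivative f x) (at x within {a..b})" for x
    using has_field_derivative_at_within[OF assms(1)]
    by (simp add: has_real_derivative_iff_has_vector_derivative)
qed

text \<open>
  For \<open>\<theta> \<in> [0,2\<pi>]\<close> this is the solution of \<open>h'' + h = \<rho>\<close> with \<open>h(0) = h'(0) = 0\<close>,
  usually written \<open>\<integral> \<rho> s * sin (\<theta> - s)\<close> over \<open>[0,\<theta>]\<close>. Truncating the kernel instead of
  the domain keeps the domain independent of \<open>\<theta>\<close>, which makes joint continuity in \<open>\<theta>\<close> and a
  parameter evident.
\<close>

definition height :: "(real \<Rightarrow> real) \<Rightarrow> real \<Rightarrow> real" where
  "height \<rho> \<theta> = integral {0..2 * pi} (\<lambda>s. \<rho> s * sin (max 0 (\<theta> - s)))"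

definition curve_area :: "(real \<Rightarrow> real) \<Rightarrow> real" where
  "curve_area \<rho> = 1/2 * integral {0..2 * pi} (\<lambda>\<theta>. \<rho> \<theta> * height \<rho> \<theta>)"

lemma height_has_integral:
  assumes "continuous_on {0..2 * pi} \<rho>" "0 \<le> \<theta>" "\<theta> \<le> 2 * pi"
  shows "((\<lambda>s. \<rho> s * sin (\<theta> - s)) has_integral height \<rho> \<theta>) {0..\<theta>}"
proof -
  let ?f = "\<lambda>s. \<rho> s * sin (max 0 (\<theta> - s))"
  have f: "continuous_on {0..2 * pi} ?f"
    by (intro continuous_intros assms)
  then have "integral {0..\<theta>} ?f + integral {\<theta>..2 * pi} ?f = height \<rho> \<theta>"
    unfolding height_def using assms
    by (intro Henstock_Kurzweil_Integration.integral_combine integrable_continuous_real)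
  moreover have "integral {\<theta>..2 * pi} ?f = 0"
    by (subst integral_cong[where g = "\<lambda>_. 0"]) auto
  ultimately have "(?f has_integral height \<rho> \<theta>) {0..\<theta>}"
    using integrable_continuous_real[OF continuous_on_subset[OF f, of "{0..\<theta>}"]] assms
    by (metis add.right_neutral atLeastatMost_subset_iff integrable_integral order_refl)
  then show ?thesis
    by (rule has_integral_eq[rotated]) simp
qed

context convex_curve
begin

lemma height_curve:
  assumes "0 \<le> \<theta>" "\<theta> \<le> 2 * pi"
  shows "(\<gamma> \<theta> - \<gamma> 0) \<bullet> e_r \<theta> = height \<rho> \<theta>"
proof -
  have "((\<lambda>s. \<rho> s * sin (\<theta> - s)) has_integral
      (\<gamma> \<theta> - \<gamma> 0) \<bullet> e_r \<theta> - (\<gamma> 0 - \<gamma> 0) \<bullet> e_r \<theta>) {0..\<theta>}"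
    using inner_derivative assms(1) by (rule has_integral_derivative)
  moreover have "continuous_on {0..2 * pi} \<rho>"
    by (rule continuous_on_subset[OF speed_continuous]) simp
  ultimately show ?thesis
    using has_integral_unique[OF height_has_integral] assms by simp
qed

lemma enclosed_area_eq_curve_area: "enclosed_area \<gamma> = curve_area \<rho>"
  unfolding enclosed_area_curve curve_area_def
  by (intro arg_cong2[where f = "(*)"] integral_cong refl) (simp add: height_curve)

lemma curve_area_pos: "curve_area \<rho> > 0"
proof -
  let ?f = "\<lambda>\<theta>. \<rho> \<theta> * ((\<gamma> \<theta> - \<gamma> 0) \<bullet> e_r \<theta>)"
  have c: "continuous_on {0..2 * pi} ?f"
    by (intro continuous_intros continuous_on_subset[OF speed_continuous]) auto
  have nn: "?f \<theta> \<ge> 0" if "\<theta> \<in> {0..2 * pi}" for \<theta>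
    using that height_pos[of \<theta>] speed_pos[of \<theta>] endpoints
    by (cases "\<theta> = 0"; cases "\<theta> = 2 * pi") auto
  have "?f pi > 0" using height_pos[of pi] speed_pos[of pi] by simp
  then have "integral {0..2 * pi} ?f \<noteq> 0"
    by (subst integral_eq_0_iff[OF c _ nn]) (auto intro!: bexI[of _ pi])
  moreover have "integral {0..2 * pi} ?f \<ge> 0"
    using nn integrable_continuous_real[OF c] by (intro integral_nonneg) auto
  ultimately show ?thesis
    using enclosed_area_curve by (simp add: enclosed_area_eq_curve_area)
qed

end

text \<open>
  The two integral conditions say that the antiderivative of \<open>\<rho> e_theta\<close> returns to its starting
  point after one turn.
\<close>

lemma convex_curve_exists:
  assumes c: "continuous_on UNIV \<rho>" and pos: "\<And>\<theta>. \<rho> \<theta> > 0" and per: "circle_fun \<rho>"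
    and "integral {0..2 * pi} (\<lambda>\<theta>. \<rho> \<theta> * sin \<theta>) = 0"
    and "integral {0..2 * pi} (\<lambda>\<theta>. \<rho> \<theta> * cos \<theta>) = 0"
  obtains \<gamma> where "convex_curve \<gamma> \<rho>"
proof -
  have "continuous_on UNIV (\<lambda>\<theta>. \<rho> \<theta> *\<^sub>R e_theta \<theta>)"
    by (intro continuous_intros c)
  then have "isCont (\<lambda>\<theta>. \<rho> \<theta> *\<^sub>R e_theta \<theta>) x" for x
    by (simp add: continuous_on_eq_continuous_at)
  then obtain \<gamma> where \<gamma>: "(\<gamma> has_vector_derivative \<rho> x *\<^sub>R e_theta x) (at x)" for x
    using einterval_antiderivative[of "- \<infinity>" \<infinity> "\<lambda>\<theta>. \<rho> \<theta> *\<^sub>R e_theta \<theta>"] by auto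
  have comp: "((\<lambda>x. \<gamma> x $ i) has_real_derivative \<rho> x * e_theta x $ i) (at x)" for x i
    using bounded_linear.has_vector_derivative[OF bounded_linear_vec_nth \<gamma>, of i]
    by (simp add: has_real_derivative_iff_has_vector_derivative)
  have ftc: "((\<lambda>x. \<rho> x * e_theta x $ i) has_integral \<gamma> (2 * pi) $ i - \<gamma> 0 $ i) {0..2 * pi}" for i
    using comp by (rule has_integral_derivative) simp
  have closes: "\<gamma> (2 * pi) = \<gamma> 0"
    using integral_unique[OF ftc[of 1]] integral_unique[OF ftc[of 2]] assms(4,5)
    by (intro vec2_eqI) simp_all
  have "circle_fun \<gamma>"
    unfolding circle_fun_def
  proof
    fix \<theta>
    have d: "((\<lambda>x. \<gamma> (x + 2 * pi) - \<gamma> x) has_vector_derivative 0) (at x)" for x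
    proof -
      have "((\<lambda>x. x + 2 * pi) has_vector_derivative 1) (at x)"
        by (auto intro!: derivative_eq_intros)
      from vector_diff_chain_at[OF this \<gamma>]
      have "((\<lambda>x. \<gamma> (x + 2 * pi)) has_vector_derivative \<rho> x *\<^sub>R e_theta x) (at x)"
        using per by (simp add: o_def circle_fun_def e_theta_def)
      from has_vector_derivative_diff[OF this \<gamma>] show ?thesis by simp
    qed
    have "\<gamma> (\<theta> + 2 * pi) - \<gamma> \<theta> = \<gamma> (0 + 2 * pi) - \<gamma> 0"
      using has_vector_derivative_zero_constant[of UNIV "\<lambda>x. \<gamma> (x + 2 * pi) - \<gamma> x"] d
      by (metis UNIV_I convex_UNIV)
    then show "\<gamma> (\<theta> + 2 * pi) = \<gamma> \<theta>" using closes by simp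
  qed
  then have "convex_curve \<gamma> \<rho>"
    using \<gamma> pos c by unfold_locales
  then show ?thesis by (rule that)
qed

lemma height_eq:
  assumes "continuous_on {0..2 * pi} \<rho>" "0 \<le> \<theta>" "\<theta> \<le> 2 * pi"
  shows "height \<rho> \<theta> = sin \<theta> * integral {0..\<theta>} (\<lambda>s. \<rho> s * cos s)
      - cos \<theta> * integral {0..\<theta>} (\<lambda>s. \<rho> s * sin s)"
proof -
  have c: "continuous_on {0..\<theta>} \<rho>" using assms by (auto intro: continuous_on_subset)
  have "((\<lambda>s. sin \<theta> * (\<rho> s * cos s) - cos \<theta> * (\<rho> s * sin s)) has_integral
     sin \<theta> * integral {0..\<theta>} (\<lambda>s. \<rho> s * cos s) - cos \<theta> * integral {0..\<theta>} (\<lambda>s. \<rho> s * sin s)) {0..\<theta>}"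
    by (intro has_integral_diff has_integral_mult_right integrable_integral
        integrable_continuous_real continuous_intros c)
  moreover have "(\<lambda>s. sin \<theta> * (\<rho> s * cos s) - cos \<theta> * (\<rho> s * sin s)) = (\<lambda>s. \<rho> s * sin (\<theta> - s))"
    by (simp add: sin_diff algebra_simps)
  ultimately show ?thesis
    using height_has_integral[OF assms] by (metis has_integral_unique)
qed

text \<open>
  Green's identity for the operator \<open>h \<mapsto> h'' + h\<close>, which sends the height to \<open>\<rho>\<close>. The height
  and its derivative vanish at \<open>0\<close> by construction and at \<open>2\<pi>\<close> by the orthogonality
  conditions, so no boundary terms remain.
\<close>

lemma integral_height_oscillator:
  assumes c: "continuous_on {0..2 * pi} \<rho>"
    and w: "\<And>\<theta>. (w has_real_derivative w1 \<theta>) (at \<theta>)"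
    and w1: "\<And>\<theta>. (w1 has_real_derivative w2 \<theta>) (at \<theta>)"
    and w2: "continuous_on UNIV w2"
    and sin0: "integral {0..2 * pi} (\<lambda>\<theta>. \<rho> \<theta> * sin \<theta>) = 0"
    and cos0: "integral {0..2 * pi} (\<lambda>\<theta>. \<rho> \<theta> * cos \<theta>) = 0"
  shows "((\<lambda>\<theta>. height \<rho> \<theta> * (w2 \<theta> + w \<theta>) - \<rho> \<theta> * w \<theta>) has_integral 0) {0..2 * pi}"
proof -
  define C where "C \<theta> = integral {0..\<theta>} (\<lambda>s. \<rho> s * cos s)" for \<theta>
  define S where "S \<theta> = integral {0..\<theta>} (\<lambda>s. \<rho> s * sin s)" for \<theta>
  define H where "H \<theta> = sin \<theta> * C \<theta> - cos \<theta> * S \<theta>" for \<theta>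
  have dC: "(C has_real_derivative \<rho> \<theta> * cos \<theta>) (at \<theta> within {0..2 * pi})"
    and dS: "(S has_real_derivative \<rho> \<theta> * sin \<theta>) (at \<theta> within {0..2 * pi})"
    if "\<theta> \<in> {0..2 * pi}" for \<theta>
    unfolding C_def[abs_def] S_def[abs_def] using that
    by (auto intro!: integral_has_real_derivative continuous_intros c)
  \<comment> \<open>The Wronskian \<open>H w' - H' w\<close>, where \<open>H' = cos \<theta> * C \<theta> + sin \<theta> * S \<theta>\<close>.\<close>
  have "((\<lambda>\<theta>. H \<theta> * w1 \<theta> - (cos \<theta> * C \<theta> + sin \<theta> * S \<theta>) * w \<theta>) has_real_derivative
      H \<theta> * (w2 \<theta> + w \<theta>) - \<rho> \<theta> * w \<theta>) (at \<theta> within {0..2 * pi})" if "\<theta> \<in> {0..2 * pi}" for \<theta>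
  proof -
    have trig: "\<rho> \<theta> * (cos \<theta>)\<^sup>2 + \<rho> \<theta> * (sin \<theta>)\<^sup>2 = \<rho> \<theta>" by (simp flip: distrib_left)
    have "((\<lambda>\<theta>. H \<theta> * w1 \<theta> - (cos \<theta> * C \<theta> + sin \<theta> * S \<theta>) * w \<theta>) has_real_derivative
       H \<theta> * (w2 \<theta> + w \<theta>) - (\<rho> \<theta> * (cos \<theta>)\<^sup>2 + \<rho> \<theta> * (sin \<theta>)\<^sup>2) * w \<theta>) (at \<theta> within {0..2 * pi})"
      unfolding H_def
      by (rule derivative_eq_intros dC[OF that] dS[OF that] has_field_derivative_at_within[OF w]
          has_field_derivative_at_within[OF w1] refl)+
        (simp add: algebra_simps power2_eq_square)
    then show ?thesis unfolding trig .
  qed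
  then have "((\<lambda>\<theta>. H \<theta> * (w2 \<theta> + w \<theta>) - \<rho> \<theta> * w \<theta>) has_integral
      (H (2 * pi) * w1 (2 * pi) - (cos (2 * pi) * C (2 * pi) + sin (2 * pi) * S (2 * pi)) * w (2 * pi))
      - (H 0 * w1 0 - (cos 0 * C 0 + sin 0 * S 0) * w 0)) {0..2 * pi}"
    by (intro fundamental_theorem_of_calculus)
      (auto simp: has_real_derivative_iff_has_vector_derivative)
  moreover have "C (2 * pi) = 0" "S (2 * pi) = 0" "C 0 = 0" "S 0 = 0"
    using sin0 cos0 by (simp_all add: C_def S_def)
  ultimately have "((\<lambda>\<theta>. H \<theta> * (w2 \<theta> + w \<theta>) - \<rho> \<theta> * w \<theta>) has_integral 0) {0..2 * pi}"
    by (simp add: H_def)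
  then show ?thesis
    by (rule has_integral_eq[rotated]) (simp add: height_eq[OF c] H_def C_def S_def)
qed


lemma continuous_on_strip_compose:
  assumes "continuous_on (UNIV \<times> I) (\<lambda>(\<theta>, t). k \<theta> t)"
    and "continuous_on S a" "continuous_on S b" "\<And>x. x \<in> S \<Longrightarrow> b x \<in> I"
  shows "continuous_on S (\<lambda>x. k (a x) (b x))"
proof -
  have "continuous_on S (\<lambda>x. (a x, b x))" by (intro continuous_intros assms)
  from continuous_on_compose2[OF assms(1) this] assms(4) show ?thesis by auto
qed

lemma continuous_on_slice:
  assumes "continuous_on (UNIV \<times> I) (\<lambda>(\<theta>, t). k \<theta> t)" "s \<in> I"
  shows "continuous_on S (\<lambda>\<theta>. k \<theta> s)"
  by (rule continuous_on_strip_compose[OF assms(1)]) (auto intro!: continuous_intros assms)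

lemma continuous_on_swap:
  assumes "continuous_on (UNIV \<times> I) (\<lambda>(\<theta>, t). k \<theta> t)"
  shows "continuous_on (I \<times> S) (\<lambda>(t, \<theta>). k \<theta> t)"
  unfolding split_beta
  by (rule continuous_on_strip_compose[OF assms]) (auto intro!: continuous_intros)

text \<open>
  If \<open>\<rho>\<close> changes by \<open>- (w'' + w)\<close>, then the height changes by \<open>- w\<close> up to a combination of
  \<open>cos\<close> and \<open>sin\<close>. That combination is the motion of the base point \<open>\<gamma> 0\<close> to which the height refers.
\<close>

lemma height_flow:
  assumes I: "convex I" "t \<in> I" and \<theta>: "0 \<le> \<theta>" "\<theta> \<le> 2 * pi"
    and \<rho>: "continuous_on (UNIV \<times> I) (\<lambda>(\<theta>, t). \<rho> \<theta> t)"
    and \<rho>t: "\<And>\<theta> t. t \<in> I \<Longrightarrow> ((\<lambda>t. \<rho> \<theta> t) has_real_derivative - (w2 \<theta> t + w \<theta> t)) (at t within I)"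
    and w: "\<And>\<theta> t. t \<in> I \<Longrightarrow> ((\<lambda>\<theta>. w \<theta> t) has_real_derivative w1 \<theta> t) (at \<theta>)"
    and w1: "\<And>\<theta> t. t \<in> I \<Longrightarrow> ((\<lambda>\<theta>. w1 \<theta> t) has_real_derivative w2 \<theta> t) (at \<theta>)"
    and cw: "continuous_on (UNIV \<times> I) (\<lambda>(\<theta>, t). w \<theta> t)"
    and cw2: "continuous_on (UNIV \<times> I) (\<lambda>(\<theta>, t). w2 \<theta> t)"
  shows "((\<lambda>t. height (\<lambda>\<theta>. \<rho> \<theta> t) \<theta>) has_real_derivative
           - (w \<theta> t - cos \<theta> * w 0 t - sin \<theta> * w1 0 t)) (at t within I)"
proof -
  have "((\<lambda>t. integral (cbox 0 \<theta>) (\<lambda>s. \<rho> s t * sin (\<theta> - s))) has_real_derivative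
      integral (cbox 0 \<theta>) (\<lambda>s. - (w2 s t + w s t) * sin (\<theta> - s))) (at t within I)"
  proof (rule leibniz_rule_field_derivative[OF _ _ _ I(2,1)])
    fix t s assume "t \<in> I"
    then show "((\<lambda>t. \<rho> s t * sin (\<theta> - s)) has_real_derivative
        - (w2 s t + w s t) * sin (\<theta> - s)) (at t within I)"
      by (intro DERIV_cmult_right \<rho>t)
  next
    fix t assume "t \<in> I"
    then show "(\<lambda>s. \<rho> s t * sin (\<theta> - s)) integrable_on cbox 0 \<theta>"
      by (intro integrable_continuous continuous_intros continuous_on_slice[OF \<rho>])
  next
    show "continuous_on (I \<times> cbox 0 \<theta>) (\<lambda>(t, s). - (w2 s t + w s t) * sin (\<theta> - s))"
      using continuous_on_swap[OF cw] continuous_on_swap[OF cw2] unfolding split_beta by (intro continuous_intros)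
  qed
  \<comment> \<open>An antiderivative of \<open>(w'' + w) sin (\<theta> - s)\<close> is \<open>w' sin (\<theta> - s) + w cos (\<theta> - s)\<close>.\<close>
  moreover have "((\<lambda>s. - (w2 s t + w s t) * sin (\<theta> - s)) has_integral
       - (w1 \<theta> t * sin (\<theta> - \<theta>) + w \<theta> t * cos (\<theta> - \<theta>))
       - - (w1 0 t * sin (\<theta> - 0) + w 0 t * cos (\<theta> - 0))) {0..\<theta>}"
    by (rule has_integral_derivative[OF _ \<theta>(1)])
      (rule derivative_eq_intros w[OF I(2)] w1[OF I(2)] refl | simp add: algebra_simps)+
  ultimately have "((\<lambda>t. integral {0..\<theta>} (\<lambda>s. \<rho> s t * sin (\<theta> - s))) has_real_derivative
      - (w \<theta> t - cos \<theta> * w 0 t - sin \<theta> * w1 0 t)) (at t within I)"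
    by (simp add: integral_unique algebra_simps)
  then show ?thesis
  proof (rule has_field_derivative_transform_within[OF _ zero_less_one I(2)])
    fix s assume "s \<in> I"
    then show "integral {0..\<theta>} (\<lambda>x. \<rho> x s * sin (\<theta> - x)) = height (\<lambda>\<theta>. \<rho> \<theta> s) \<theta>"
      using height_has_integral[OF continuous_on_slice[OF \<rho> \<open>s \<in> I\<close>] \<theta>] by (simp add: integral_unique)
  qed
qed

text \<open>
  The first variation of area. Both factors of \<open>\<rho> h\<close> contribute \<open>- \<integral> \<rho> w\<close>: the variation of
  \<open>\<rho>\<close> by Green's identity, and that of \<open>h\<close> because the motion of the base point is a combination
  of \<open>cos\<close> and \<open>sin\<close>, to which \<open>\<rho>\<close> is orthogonal.
\<close>

lemma curve_area_flow:
  assumes I: "convex I" "t \<in> I"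
    and \<rho>: "continuous_on (UNIV \<times> I) (\<lambda>(\<theta>, t). \<rho> \<theta> t)"
    and \<rho>t: "\<And>\<theta> t. t \<in> I \<Longrightarrow> ((\<lambda>t. \<rho> \<theta> t) has_real_derivative - (w2 \<theta> t + w \<theta> t)) (at t within I)"
    and w: "\<And>\<theta> t. t \<in> I \<Longrightarrow> ((\<lambda>\<theta>. w \<theta> t) has_real_derivative w1 \<theta> t) (at \<theta>)"
    and w1: "\<And>\<theta> t. t \<in> I \<Longrightarrow> ((\<lambda>\<theta>. w1 \<theta> t) has_real_derivative w2 \<theta> t) (at \<theta>)"
    and cw: "continuous_on (UNIV \<times> I) (\<lambda>(\<theta>, t). w \<theta> t)"
    and cw1: "continuous_on (UNIV \<times> I) (\<lambda>(\<theta>, t). w1 \<theta> t)"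
    and cw2: "continuous_on (UNIV \<times> I) (\<lambda>(\<theta>, t). w2 \<theta> t)"
    and sin0: "integral {0..2 * pi} (\<lambda>\<theta>. \<rho> \<theta> t * sin \<theta>) = 0"
    and cos0: "integral {0..2 * pi} (\<lambda>\<theta>. \<rho> \<theta> t * cos \<theta>) = 0"
  shows "((\<lambda>t. curve_area (\<lambda>\<theta>. \<rho> \<theta> t)) has_real_derivative
           - integral {0..2 * pi} (\<lambda>\<theta>. \<rho> \<theta> t * w \<theta> t)) (at t within I)"
proof -
  let ?J = "cbox 0 (2 * pi)"
  let ?H = "\<lambda>\<theta> t. height (\<lambda>\<theta>. \<rho> \<theta> t) \<theta>"
  let ?Ht = "\<lambda>\<theta> t. - (w \<theta> t - cos \<theta> * w 0 t - sin \<theta> * w1 0 t)"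
  have start: "continuous_on (I \<times> S) (\<lambda>(t, s). k 0 t)"
    if "continuous_on (UNIV \<times> I) (\<lambda>(\<theta>, t). k \<theta> t)" for S :: "real set" and k :: "real \<Rightarrow> real \<Rightarrow> real"
    unfolding split_beta
    by (rule continuous_on_strip_compose[OF that]) (auto intro!: continuous_intros)
  have cH: "continuous_on (I \<times> ?J) (\<lambda>(t, \<theta>). ?H \<theta> t)"
  proof -
    have "continuous_on ((I \<times> ?J) \<times> ?J) (\<lambda>(p, s). \<rho> s (fst p) * sin (max 0 (snd p - s)))"
      unfolding split_beta
      by (intro continuous_intros continuous_on_strip_compose[OF \<rho>]) auto
    from integral_continuous_on_param[OF this] show ?thesis
      by (simp add: height_def split_beta)
  qed
  have cHt: "continuous_on (I \<times> ?J) (\<lambda>(t, \<theta>). ?Ht \<theta> t)"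
    using continuous_on_swap[OF cw] start[OF cw] start[OF cw1]
    unfolding split_beta by (intro continuous_intros)
  have sliceH: "continuous_on ?J (\<lambda>\<theta>. ?H \<theta> s)" if "s \<in> I" for s
  proof -
    have "continuous_on ?J (\<lambda>\<theta>. (s, \<theta>))" by (intro continuous_intros)
    from continuous_on_compose2[OF cH this] that show ?thesis by auto
  qed
  let ?d = "\<lambda>t \<theta>. - (w2 \<theta> t + w \<theta> t) * ?H \<theta> t + ?Ht \<theta> t * \<rho> \<theta> t"
  have "((\<lambda>t. integral ?J (\<lambda>\<theta>. \<rho> \<theta> t * ?H \<theta> t)) has_real_derivative integral ?J (?d t)) (at t within I)"
  proof (rule leibniz_rule_field_derivative[OF _ _ _ I(2,1)])
    fix t \<theta> assume "t \<in> I" "\<theta> \<in> ?J"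
    then show "((\<lambda>t. \<rho> \<theta> t * ?H \<theta> t) has_real_derivative ?d t \<theta>) (at t within I)"
      by (intro DERIV_mult \<rho>t height_flow[OF I(1) _ _ _ \<rho> \<rho>t w w1 cw cw2]) auto
  next
    fix t assume "t \<in> I"
    then show "(\<lambda>\<theta>. \<rho> \<theta> t * ?H \<theta> t) integrable_on ?J"
      by (intro integrable_continuous continuous_on_mult continuous_on_slice[OF \<rho>] sliceH)
  next
    show "continuous_on (I \<times> ?J) (\<lambda>(t, \<theta>). ?d t \<theta>)"
      unfolding split_beta
      by (rule continuous_on_add[OF
            continuous_on_mult[OF continuous_on_minus[OF continuous_on_add[OF
              continuous_on_swap[OF cw2] continuous_on_swap[OF cw]]] cH]
            continuous_on_mult[OF cHt continuous_on_swap[OF \<rho>]], unfolded split_beta])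
  qed
  moreover have "(?d t has_integral - 2 * integral {0..2 * pi} (\<lambda>\<theta>. \<rho> \<theta> t * w \<theta> t)) {0..2 * pi}"
  proof -
    have 1: "((\<lambda>\<theta>. ?H \<theta> t * (w2 \<theta> t + w \<theta> t) - \<rho> \<theta> t * w \<theta> t) has_integral 0) {0..2 * pi}"
      by (rule integral_height_oscillator[OF continuous_on_slice[OF \<rho> I(2)] w[OF I(2)] w1[OF I(2)]
            continuous_on_slice[OF cw2 I(2)] sin0 cos0])
    have 2: "((\<lambda>\<theta>. \<rho> \<theta> t * w \<theta> t) has_integral integral {0..2 * pi} (\<lambda>\<theta>. \<rho> \<theta> t * w \<theta> t)) {0..2 * pi}"
      by (intro integrable_integral integrable_continuous_real continuous_on_mult
          continuous_on_slice[OF \<rho> I(2)] continuous_on_slice[OF cw I(2)])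
    have 3: "((\<lambda>\<theta>. \<rho> \<theta> t * sin \<theta>) has_integral 0) {0..2 * pi}"
      by (rule has_integral_eq_rhs[OF integrable_integral sin0[symmetric]])
        (intro integrable_continuous_real continuous_intros continuous_on_slice[OF \<rho> I(2)])
    have 4: "((\<lambda>\<theta>. \<rho> \<theta> t * cos \<theta>) has_integral 0) {0..2 * pi}"
      by (rule has_integral_eq_rhs[OF integrable_integral cos0[symmetric]])
        (intro integrable_continuous_real continuous_intros continuous_on_slice[OF \<rho> I(2)])
    have "((\<lambda>\<theta>. - 1 * (?H \<theta> t * (w2 \<theta> t + w \<theta> t) - \<rho> \<theta> t * w \<theta> t) + - 2 * (\<rho> \<theta> t * w \<theta> t)
        + w 0 t * (\<rho> \<theta> t * cos \<theta>) + w1 0 t * (\<rho> \<theta> t * sin \<theta>)) has_integral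
        - 1 * 0 + - 2 * integral {0..2 * pi} (\<lambda>\<theta>. \<rho> \<theta> t * w \<theta> t) + w 0 t * 0 + w1 0 t * 0) {0..2 * pi}"
      by (intro has_integral_add has_integral_mult_right 1 2 3 4)
    then show ?thesis by (rule has_integral_eq_rhs[OF has_integral_eq[rotated]]) (simp_all add: algebra_simps)
  qed
  ultimately have "((\<lambda>t. integral ?J (\<lambda>\<theta>. \<rho> \<theta> t * ?H \<theta> t)) has_real_derivative
      - 2 * integral {0..2 * pi} (\<lambda>\<theta>. \<rho> \<theta> t * w \<theta> t)) (at t within I)"
    by (simp add: integral_unique)
  from DERIV_cmult[OF this, of "1/2"] show ?thesis
    by (simp add: curve_area_def)
qed

text \<open>
  Curves stay closed: \<open>w'' + w\<close> is orthogonal to every periodic solution \<open>e\<close> of \<open>e'' + e = 0\<close>.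
\<close>

lemma closure_flow:
  assumes I: "convex I" "0 \<in> I" "t \<in> I"
    and \<rho>: "continuous_on (UNIV \<times> I) (\<lambda>(\<theta>, t). \<rho> \<theta> t)"
    and \<rho>t: "\<And>\<theta> t. t \<in> I \<Longrightarrow> ((\<lambda>t. \<rho> \<theta> t) has_real_derivative - (w2 \<theta> t + w \<theta> t)) (at t within I)"
    and w: "\<And>\<theta> t. t \<in> I \<Longrightarrow> ((\<lambda>\<theta>. w \<theta> t) has_real_derivative w1 \<theta> t) (at \<theta>)"
    and w1: "\<And>\<theta> t. t \<in> I \<Longrightarrow> ((\<lambda>\<theta>. w1 \<theta> t) has_real_derivative w2 \<theta> t) (at \<theta>)"
    and cw: "continuous_on (UNIV \<times> I) (\<lambda>(\<theta>, t). w \<theta> t)"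
    and cw2: "continuous_on (UNIV \<times> I) (\<lambda>(\<theta>, t). w2 \<theta> t)"
    and per: "\<And>t. t \<in> I \<Longrightarrow> w (2 * pi) t = w 0 t" "\<And>t. t \<in> I \<Longrightarrow> w1 (2 * pi) t = w1 0 t"
    and e: "\<And>\<theta>. (e has_real_derivative e' \<theta>) (at \<theta>)" "\<And>\<theta>. (e' has_real_derivative - e \<theta>) (at \<theta>)"
      "e (2 * pi) = e 0" "e' (2 * pi) = e' 0"
    and init: "integral {0..2 * pi} (\<lambda>\<theta>. \<rho> \<theta> 0 * e \<theta>) = 0"
  shows "integral {0..2 * pi} (\<lambda>\<theta>. \<rho> \<theta> t * e \<theta>) = 0"
proof -
  let ?J = "cbox 0 (2 * pi)"
  have ce: "continuous_on S e" for S
    by (meson DERIV_isCont continuous_at_imp_continuous_on e(1))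
  have "((\<lambda>t. integral ?J (\<lambda>\<theta>. \<rho> \<theta> t * e \<theta>)) has_real_derivative 0) (at t within I)"
    if t: "t \<in> I" for t
  proof -
    have "((\<lambda>t. integral ?J (\<lambda>\<theta>. \<rho> \<theta> t * e \<theta>)) has_real_derivative
      integral ?J (\<lambda>\<theta>. - (w2 \<theta> t + w \<theta> t) * e \<theta>)) (at t within I)"
    proof (rule leibniz_rule_field_derivative[OF _ _ _ t I(1)])
      fix t \<theta> assume "t \<in> I"
      then show "((\<lambda>t. \<rho> \<theta> t * e \<theta>) has_real_derivative - (w2 \<theta> t + w \<theta> t) * e \<theta>) (at t within I)"
        by (intro DERIV_cmult_right \<rho>t)
    next
      fix t assume "t \<in> I"
      then show "(\<lambda>\<theta>. \<rho> \<theta> t * e \<theta>) integrable_on ?J"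
        by (intro integrable_continuous continuous_on_mult continuous_on_slice[OF \<rho>] ce)
    next
      show "continuous_on (I \<times> ?J) (\<lambda>(t, \<theta>). - (w2 \<theta> t + w \<theta> t) * e \<theta>)"
        using continuous_on_swap[OF cw] continuous_on_swap[OF cw2] unfolding split_beta
        by (intro continuous_intros continuous_on_compose2[OF ce[of UNIV]]) auto
    qed
    moreover have "((\<lambda>\<theta>. - (w2 \<theta> t + w \<theta> t) * e \<theta>) has_integral
        - (w1 (2 * pi) t * e (2 * pi) - w (2 * pi) t * e' (2 * pi))
        - - (w1 0 t * e 0 - w 0 t * e' 0)) {0..2 * pi}"
      by (rule has_integral_derivative)
        (rule derivative_eq_intros w[OF t] w1[OF t] e refl | simp add: algebra_simps)+
    ultimately show ?thesis using per[OF t] e by (simp add: integral_unique)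
  qed
  then obtain k where "\<forall>t\<in>I. integral ?J (\<lambda>\<theta>. \<rho> \<theta> t * e \<theta>) = k"
    using has_field_derivative_zero_constant[OF I(1)] by blast
  with I init show ?thesis by (metis cbox_interval)
qed


section \<open>Derivatives relative to a set, and a linear equation\<close>

lemma deriv_on_UNIV: "deriv_on UNIV = deriv"
  by (intro ext)
    (simp add: deriv_on_def deriv_def vector_derivative_def has_real_derivative_iff_has_vector_derivative)

lemma smooth_on_UNIV_DERIV:
  assumes "smooth_on UNIV h"
  shows "((deriv ^^ n) h has_real_derivative (deriv ^^ Suc n) h x) (at x)"
  using assms by (simp add: smooth_on_def deriv_on_UNIV DERIV_deriv_iff_real_differentiable)

lemma deriv_on_eqI:
  assumes "(h has_real_derivative D) (at x within S)" "at x within S \<noteq> bot"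
  shows "deriv_on S h x = D"
  using assms unfolding deriv_on_def
  by (intro vector_derivative_within) (auto simp: has_real_derivative_iff_has_vector_derivative)

lemma differentiable_deriv_on:
  assumes "h differentiable (at x within S)"
  shows "(h has_real_derivative deriv_on S h x) (at x within S)"
  using assms unfolding deriv_on_def
  by (simp add: has_real_derivative_iff_has_vector_derivative vector_derivative_works)

lemma circle_fun_deriv:
  assumes "circle_fun h"
  shows "circle_fun (deriv h)"
proof -
  have "(\<lambda>x. h (x + 2 * pi)) = h" using assms by (auto simp: circle_fun_def)
  then have "(h has_real_derivative D) (at (\<theta> + 2 * pi)) \<longleftrightarrow> (h has_real_derivative D) (at \<theta>)" for D \<theta>
    using DERIV_shift[of h D \<theta> "2 * pi"] by simp
  then show ?thesis by (simp add: circle_fun_def deriv_def)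
qed

text \<open>
  The integrating factor \<open>exp (- \<integral> c)\<close> turns \<open>y\<close> into a constant.
\<close>

lemma linear_ode_pos:
  fixes y c :: "real \<Rightarrow> real"
  assumes "0 \<le> t" and c: "continuous_on {0..t} c" and "y 0 > 0"
    and y: "\<And>s. s \<in> {0..t} \<Longrightarrow> (y has_real_derivative c s * y s) (at s within {0..t})"
  shows "y t > 0"
proof -
  define E where "E s = integral {0..s} c" for s
  have E: "(E has_real_derivative c s) (at s within {0..t})" if "s \<in> {0..t}" for s
    unfolding E_def[abs_def] using that c by (intro integral_has_real_derivative)
  have "((\<lambda>s. y s * exp (- E s)) has_real_derivative 0) (at s within {0..t})" if "s \<in> {0..t}" for s
    by (rule derivative_eq_intros y[OF that] E[OF that] refl | simp)+
  then obtain k where k: "\<And>s. s \<in> {0..t} \<Longrightarrow> y s * exp (- E s) = k"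
    using has_field_derivative_zero_constant[of "{0..t}" "\<lambda>s. y s * exp (- E s)"] by auto
  have "y t * exp (- E t) = y 0 * exp (- E 0)"
    using k[of t] k[of 0] assms(1) by simp
  then have "y t * exp (- E t) > 0" using assms(3) by simp
  then show ?thesis by (simp add: zero_less_mult_iff)
qed

lemma family_F_differentiable:
  assumes "f \<in> family_F" "0 \<le> t"
  shows "(deriv_on {0..} ^^ n) f differentiable (at t within {0..})"
  using assms by (simp add: family_F_def smooth_on_def)

lemma family_F_DERIV:
  assumes "f \<in> family_F" "0 \<le> t"
  shows "(f has_real_derivative deriv_on {0..} f t) (at t within {0..})"
  using differentiable_deriv_on[of f t "{0..}"] family_F_differentiable[OF assms, of 0] by simp

lemma family_F_continuous:
  assumes "f \<in> family_F"
  shows "continuous_on {0..} (deriv_on {0..} f)" "continuous_on {0..} f"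
  using family_F_differentiable[OF assms, of _ 1] family_F_differentiable[OF assms, of _ 0]
  by (auto simp: continuous_on_eq_continuous_within intro!: differentiable_imp_continuous_within)

section \<open>Curves of prescribed minkowskian curvature\<close>

locale minkowski_norm =
  fixes g :: "real \<Rightarrow> real"
  assumes smooth: "smooth_on UNIV g" and periodic: "circle_fun g"
    and pos: "\<And>\<theta>. g \<theta> > 0" and convex: "\<And>\<theta>. g \<theta> + deriv (deriv g) \<theta> > 0"
begin

definition "a \<theta> = g \<theta> + deriv (deriv g) \<theta>"

lemma a_pos: "a \<theta> > 0"
  using convex by (simp add: a_def)

lemma deriv_g: "(g has_real_derivative deriv g \<theta>) (at \<theta>)"
  and deriv2_g: "(deriv g has_real_derivative deriv (deriv g) \<theta>) (at \<theta>)"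
  and deriv3_g: "(deriv (deriv g) has_real_derivative deriv (deriv (deriv g)) \<theta>) (at \<theta>)"
  using smooth_on_UNIV_DERIV[OF smooth, of 0 \<theta>] smooth_on_UNIV_DERIV[OF smooth, of 1 \<theta>]
    smooth_on_UNIV_DERIV[OF smooth, of 2 \<theta>] by (simp_all add: numeral_2_eq_2)

lemma continuous_g: "continuous_on S g" "continuous_on S (deriv g)" "continuous_on S (deriv (deriv g))"
  by (meson DERIV_isCont continuous_at_imp_continuous_on deriv_g deriv2_g deriv3_g)+

lemma continuous_a: "continuous_on S a"
  unfolding a_def[abs_def] by (intro continuous_intros continuous_g)

lemma circle_fun_a: "circle_fun a"
  using periodic circle_fun_deriv[OF circle_fun_deriv[OF periodic]]
  by (simp add: a_def circle_fun_def)

lemma p_curve_tangent: "(p_curve g has_vector_derivative a \<theta> *\<^sub>R e_theta \<theta>) (at \<theta>)"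
proof -
  have "(p_curve g has_vector_derivative
      (g \<theta> *\<^sub>R e_theta \<theta> + deriv g \<theta> *\<^sub>R e_r \<theta>) + (deriv g \<theta> *\<^sub>R (- e_r \<theta>) + deriv (deriv g) \<theta> *\<^sub>R e_theta \<theta>)) (at \<theta>)"
    unfolding p_curve_def[abs_def]
    by (intro has_vector_derivative_add has_vector_derivative_scaleR deriv_g deriv2_g
        e_r_has_vector_derivative e_theta_has_vector_derivative)
  then show ?thesis by (simp add: a_def algebra_simps)
qed

sublocale p: convex_curve "p_curve g" a
proof
  show "circle_fun (p_curve g)"
    using periodic circle_fun_deriv[OF periodic]
    by (simp add: circle_fun_def p_curve_def e_r_def e_theta_def)
qed (rule p_curve_tangent a_pos continuous_a)+

lemma p_curve'_eq: "p_curve' g \<theta> = a \<theta> *\<^sub>R e_theta \<theta>"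
  unfolding p_curve'_def by (rule vector_derivative_at[OF p_curve_tangent])

lemma bracket_p: "bracket (p_curve g \<theta>) (p_curve' g \<theta>) = g \<theta> * a \<theta>"
proof -
  have "bracket (p_curve g \<theta>) (p_curve' g \<theta>)
      = (g \<theta> * a \<theta>) * (cos \<theta> * cos \<theta>) + (g \<theta> * a \<theta>) * (sin \<theta> * sin \<theta>)"
    unfolding p_curve'_eq by (simp add: bracket_def det_2 p_curve_def algebra_simps)
  also have "\<dots> = g \<theta> * a \<theta> * (cos \<theta> * cos \<theta> + sin \<theta> * sin \<theta>)"
    by (simp only: distrib_left)
  finally show ?thesis by simp
qed

lemma q_curve_eq: "q_curve g \<theta> = (1 / g \<theta>) *\<^sub>R e_theta \<theta>"
  unfolding q_curve_def bracket_p using a_pos[of \<theta>] pos[of \<theta>] by (simp add: p_curve'_eq)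

lemma has_minkowskian_curvature_iff:
  assumes k: "continuous_on UNIV k" "\<And>\<theta>. k \<theta> > 0"
  shows "has_minkowskian_curvature g \<gamma> k \<longleftrightarrow> convex_curve \<gamma> (\<lambda>\<theta>. a \<theta> / k \<theta>)"
proof
  assume "has_minkowskian_curvature g \<gamma> k"
  then obtain l where per: "circle_fun \<gamma>" and l: "\<And>\<theta>. l \<theta> > 0"
    "\<And>\<theta>. (\<gamma> has_vector_derivative l \<theta> *\<^sub>R q_curve g \<theta>) (at \<theta>)" "\<And>\<theta>. k \<theta> = g \<theta> * a \<theta> / l \<theta>"
    unfolding has_minkowskian_curvature_def bracket_p by blast
  have "l \<theta> *\<^sub>R q_curve g \<theta> = (a \<theta> / k \<theta>) *\<^sub>R e_theta \<theta>" for \<theta>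
    using l(1)[of \<theta>] pos[of \<theta>] a_pos[of \<theta>] by (simp add: l(3) q_curve_eq field_simps)
  with l(2) per show "convex_curve \<gamma> (\<lambda>\<theta>. a \<theta> / k \<theta>)"
    using k by unfold_locales (auto intro!: continuous_intros continuous_a simp: a_pos less_imp_neq[OF k(2), symmetric])
next
  assume "convex_curve \<gamma> (\<lambda>\<theta>. a \<theta> / k \<theta>)"
  then interpret convex_curve \<gamma> "\<lambda>\<theta>. a \<theta> / k \<theta>" .
  have "g \<theta> * a \<theta> / k \<theta> > 0" "(\<gamma> has_vector_derivative (g \<theta> * a \<theta> / k \<theta>) *\<^sub>R q_curve g \<theta>) (at \<theta>)"
    "k \<theta> = g \<theta> * a \<theta> / (g \<theta> * a \<theta> / k \<theta>)" for \<theta>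
    using pos[of \<theta>] a_pos[of \<theta>] k(2)[of \<theta>] tangent[of \<theta>] by (simp_all add: q_curve_eq)
  then show "has_minkowskian_curvature g \<gamma> k"
    unfolding has_minkowskian_curvature_def bracket_p using closed_curve
    by (intro conjI exI[of _ "\<lambda>\<theta>. g \<theta> * a \<theta> / k \<theta>"]) blast+
qed

text \<open>
  The support function of \<open>p\<close> with respect to the origin is \<open>g\<close>. The area formula uses the base
  point \<open>p(0)\<close> instead; this changes the integrand by the density \<open>a\<close> times a combination of
  \<open>cos\<close> and \<open>sin\<close>, whose integral vanishes because \<open>p\<close> is closed.
\<close>

lemma enclosed_area_p: "((\<lambda>\<theta>. a \<theta> * g \<theta>) has_integral 2 * enclosed_area (p_curve g)) {0..2 * pi}"
proof -
  let ?p = "p_curve g"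
  have comp: "((\<lambda>x. ?p x $ i) has_real_derivative a x * e_theta x $ i) (at x)" for x i
    using bounded_linear.has_vector_derivative[OF bounded_linear_vec_nth p_curve_tangent, of i]
    by (simp add: has_real_derivative_iff_has_vector_derivative)
  have "((\<lambda>\<theta>. a \<theta> * (?p 0 \<bullet> e_r \<theta>)) has_integral
     (?p 0 $ 1 * ?p (2 * pi) $ 2 - ?p 0 $ 2 * ?p (2 * pi) $ 1)
     - (?p 0 $ 1 * ?p 0 $ 2 - ?p 0 $ 2 * ?p 0 $ 1)) {0..2 * pi}"
    by (rule has_integral_derivative)
      (rule derivative_eq_intros comp refl | simp add: inner_real2 algebra_simps)+
  then have 1: "((\<lambda>\<theta>. a \<theta> * (?p 0 \<bullet> e_r \<theta>)) has_integral 0) {0..2 * pi}"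
    by (simp add: p.endpoints)
  have "continuous_on {0..2 * pi} (\<lambda>\<theta>. a \<theta> * g \<theta>)"
    by (intro continuous_intros continuous_a continuous_g)
  then have 2: "((\<lambda>\<theta>. a \<theta> * g \<theta>) has_integral integral {0..2 * pi} (\<lambda>\<theta>. a \<theta> * g \<theta>)) {0..2 * pi}"
    by (intro integrable_integral integrable_continuous_real)
  have eq: "a \<theta> * g \<theta> - a \<theta> * (?p 0 \<bullet> e_r \<theta>) = a \<theta> * ((?p \<theta> - ?p 0) \<bullet> e_r \<theta>)" for \<theta>
  proof -
    have "?p \<theta> \<bullet> e_r \<theta> = g \<theta>"
      by (simp add: p_curve_def inner_add_left inner_e_theta_e_r)
    then show ?thesis by (simp add: inner_diff_left algebra_simps)
  qed
  have "integral {0..2 * pi} (\<lambda>\<theta>. a \<theta> * ((?p \<theta> - ?p 0) \<bullet> e_r \<theta>)) = integral {0..2 * pi} (\<lambda>\<theta>. a \<theta> * g \<theta>)"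
    using integral_unique[OF has_integral_diff[OF 2 1]] by (simp add: eq)
  with 2 show ?thesis by (simp add: p.enclosed_area_curve)
qed

lemma enclosed_area_p_pos: "enclosed_area (p_curve g) > 0"
  using p.curve_area_pos by (simp add: p.enclosed_area_eq_curve_area)

end

section \<open>The area bound on the lifespan\<close>

locale curvature_solution = minkowski_norm g for g +
  fixes f u\<^sub>0 :: "real \<Rightarrow> real" and I :: "real set" and u :: "real \<Rightarrow> real \<Rightarrow> real"
  assumes f: "f \<in> family_F" and u0_pos: "\<And>\<theta>. u\<^sub>0 \<theta> > 0"
    and solution: "solution_on g f u\<^sub>0 I u"
begin

abbreviation "u1 \<equiv> partial_deriv I 1 0 u"
abbreviation "u2 \<equiv> partial_deriv I 2 0 u"
abbreviation "f' \<equiv> deriv_on {0..} f"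

lemma convex_I: "convex I" and zero_in_I: "0 \<in> I" and I_nonneg: "t \<in> I \<Longrightarrow> 0 \<le> t"
  using solution by (auto simp: solution_on_def is_interval_convex_1)

lemma segment_subset_I: "t \<in> I \<Longrightarrow> {0..t} \<subseteq> I"
  using solution mem_is_interval_1_I[of I 0 t] by (auto simp: solution_on_def)

lemma u_0_0: "partial_deriv I 0 0 u = u"
  by (intro ext) (simp add: partial_deriv_def)

lemma strip: "smooth_on_strip I u"
  using solution by (simp add: solution_on_def)

lemma u_continuous: "continuous_on (UNIV \<times> I) (\<lambda>(\<theta>, t). u \<theta> t)"
  and u1_continuous: "continuous_on (UNIV \<times> I) (\<lambda>(\<theta>, t). u1 \<theta> t)"
  and u2_continuous: "continuous_on (UNIV \<times> I) (\<lambda>(\<theta>, t). u2 \<theta> t)"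
  using strip unfolding smooth_on_strip_def by (metis u_0_0)+

lemma u_theta: "t \<in> I \<Longrightarrow> ((\<lambda>\<theta>. u \<theta> t) has_real_derivative u1 \<theta> t) (at \<theta>)"
  and u1_theta: "t \<in> I \<Longrightarrow> ((\<lambda>\<theta>. u1 \<theta> t) has_real_derivative u2 \<theta> t) (at \<theta>)"
  and u_t: "t \<in> I \<Longrightarrow> ((\<lambda>t. u \<theta> t) has_real_derivative partial_deriv I 0 1 u \<theta> t) (at t within I)"
  using strip unfolding smooth_on_strip_def by (metis u_0_0 One_nat_def numeral_2_eq_2)+

lemma f_pos: "t \<in> I \<Longrightarrow> f t > 0" and f_0: "f 0 = 1" and f_ge_1: "t \<in> I \<Longrightarrow> f t \<ge> 1"
proof -
  show "t \<in> I \<Longrightarrow> f t > 0" "f 0 = 1"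
    using f I_nonneg by (auto simp: family_F_def)
  show "t \<in> I \<Longrightarrow> f t \<ge> 1"
    using f I_nonneg by (auto simp: family_F_def dest: mono_onD[of _ f 0 t])
qed

lemma I_subset: "I \<subseteq> {0..}"
  using I_nonneg by auto

lemma f_derivative: "t \<in> I \<Longrightarrow> (f has_real_derivative f' t) (at t within I)"
  using family_F_DERIV[OF f I_nonneg] I_subset by (rule has_field_derivative_subset)

lemma f'_continuous: "continuous_on I f'" and f_continuous: "continuous_on I f"
  using family_F_continuous[OF f] I_subset continuous_on_subset by blast+

lemma pde:
  assumes "t \<in> I"
  shows "partial_deriv I 0 1 u \<theta> t = g \<theta> / a \<theta> * (u \<theta> t)\<^sup>2 * u2 \<theta> t
    + 2 * deriv g \<theta> / a \<theta> * (u \<theta> t)\<^sup>2 * u1 \<theta> t + (u \<theta> t) ^ 3 + f' t / f t * u \<theta> t"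
  using solution assms unfolding solution_on_def a_def
  by (simp add: partial_deriv_def numeral_2_eq_2)

text \<open>
  For fixed \<open>\<theta>\<close> the right-hand side of the equation is \<open>u\<close> times a continuous function of time, so
  \<open>u \<theta>\<close> solves a homogeneous linear ordinary differential equation and keeps its sign.
\<close>

lemma u_pos:
  assumes t: "t \<in> I"
  shows "u \<theta> t > 0"
proof -
  define c where "c s = g \<theta> / a \<theta> * u \<theta> s * u2 \<theta> s
    + 2 * deriv g \<theta> / a \<theta> * u \<theta> s * u1 \<theta> s + (u \<theta> s)\<^sup>2 + f' s / f s" for s
  have sub: "{0..t} \<subseteq> I" by (rule segment_subset_I[OF t])
  have slice: "continuous_on {0..t} (k \<theta>)" if "continuous_on (UNIV \<times> I) (\<lambda>(\<theta>, t). k \<theta> t)"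
    for k :: "real \<Rightarrow> real \<Rightarrow> real"
    using sub by (intro continuous_on_strip_compose[OF that, of _ "\<lambda>_. \<theta>" "\<lambda>t. t"]) (auto intro!: continuous_intros)
  show ?thesis
  proof (rule linear_ode_pos[of t c "u \<theta>"])
    show "0 \<le> t" by (rule I_nonneg[OF t])
    have "f s \<noteq> 0" if "s \<in> {0..t}" for s using f_pos[of s] sub that by auto
    then show "continuous_on {0..t} c"
      unfolding c_def[abs_def]
      by (intro continuous_intros slice[OF u_continuous] slice[OF u1_continuous]
          slice[OF u2_continuous] continuous_on_subset[OF f_continuous sub] continuous_on_subset[OF f'_continuous sub]) auto
    show "u \<theta> 0 > 0" using solution u0_pos by (simp add: solution_on_def)
    fix s assume s: "s \<in> {0..t}"
    then have "partial_deriv I 0 1 u \<theta> s = c s * u \<theta> s"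
      using sub by (subst pde) (auto simp: c_def algebra_simps power2_eq_square power3_eq_cube)
    then show "(u \<theta> has_real_derivative c s * u \<theta> s) (at s within {0..t})"
      using u_t[of s \<theta>] s sub by (metis has_field_derivative_subset subsetD)
  qed
qed

text \<open>
  The density \<open>\<rho>\<close> of the rescaled curves and the inward normal speed \<open>w\<close>, with its two
  derivatives in \<open>\<theta>\<close>.
\<close>

definition "\<rho> \<theta> t = a \<theta> * f t / u \<theta> t"
definition "w \<theta> t = f t * (g \<theta> * u \<theta> t)"
definition "w1 \<theta> t = f t * (deriv g \<theta> * u \<theta> t + g \<theta> * u1 \<theta> t)"
definition "w2 \<theta> t = f t * (deriv (deriv g) \<theta> * u \<theta> t + 2 * deriv g \<theta> * u1 \<theta> t + g \<theta> * u2 \<theta> t)"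

lemma w_theta: "t \<in> I \<Longrightarrow> ((\<lambda>\<theta>. w \<theta> t) has_real_derivative w1 \<theta> t) (at \<theta>)"
  unfolding w_def w1_def
  by (rule derivative_eq_intros deriv_g u_theta refl | assumption | simp add: algebra_simps)+

lemma w1_theta: "t \<in> I \<Longrightarrow> ((\<lambda>\<theta>. w1 \<theta> t) has_real_derivative w2 \<theta> t) (at \<theta>)"
  unfolding w1_def w2_def
  by (rule derivative_eq_intros deriv_g deriv2_g u_theta u1_theta refl | assumption | simp add: algebra_simps)+

text \<open>
  The point of the rescaling: the term with \<open>f'/f\<close> cancels, and the first-order coefficient
  \<open>2 g'\<close> is exactly the one for which the spatial terms combine to \<open>(g u)'' + g u\<close>.
\<close>

lemma \<rho>_t:
  assumes t: "t \<in> I"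
  shows "((\<lambda>t. \<rho> \<theta> t) has_real_derivative - (w2 \<theta> t + w \<theta> t)) (at t within I)"
proof -
  have nz: "u \<theta> t \<noteq> 0" "a \<theta> \<noteq> 0" "f t \<noteq> 0" using u_pos[OF t, of \<theta>] a_pos[of \<theta>] f_pos[OF t] by auto
  have "((\<lambda>t. \<rho> \<theta> t) has_real_derivative
      (a \<theta> * f' t * u \<theta> t - a \<theta> * f t * partial_deriv I 0 1 u \<theta> t) / (u \<theta> t * u \<theta> t)) (at t within I)"
    unfolding \<rho>_def by (intro DERIV_divide DERIV_cmult f_derivative u_t t nz)
  moreover have "(a \<theta> * f' t * u \<theta> t - a \<theta> * f t * partial_deriv I 0 1 u \<theta> t) / (u \<theta> t * u \<theta> t)
      = - (w2 \<theta> t + w \<theta> t)"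
    using nz unfolding pde[OF t] w_def w2_def
    by (simp add: field_simps power2_eq_square power3_eq_cube) (simp add: a_def algebra_simps)
  ultimately show ?thesis by simp
qed

lemma continuous_coefficient: "continuous_on (UNIV \<times> I) (\<lambda>p. h (fst p))" if "continuous_on UNIV h" for h :: "real \<Rightarrow> real"
  by (rule continuous_on_compose2[OF that]) (auto intro!: continuous_intros)

lemma continuous_f_strip: "continuous_on (UNIV \<times> I) (\<lambda>p. f (snd p))"
  by (rule continuous_on_compose2[OF f_continuous]) (auto intro!: continuous_intros)

lemmas continuous_data =
  continuous_f_strip continuous_g[THEN continuous_coefficient] continuous_a[THEN continuous_coefficient]
  u_continuous[unfolded split_beta] u1_continuous[unfolded split_beta] u2_continuous[unfolded split_beta]

lemma \<rho>_continuous: "continuous_on (UNIV \<times> I) (\<lambda>(\<theta>, t). \<rho> \<theta> t)"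
  unfolding \<rho>_def split_beta
  by (intro continuous_intros continuous_data) (auto dest!: u_pos simp: less_le)

lemma w_continuous: "continuous_on (UNIV \<times> I) (\<lambda>(\<theta>, t). w \<theta> t)"
  and w1_continuous: "continuous_on (UNIV \<times> I) (\<lambda>(\<theta>, t). w1 \<theta> t)"
  and w2_continuous: "continuous_on (UNIV \<times> I) (\<lambda>(\<theta>, t). w2 \<theta> t)"
  unfolding w_def w1_def w2_def split_beta by (intro continuous_intros continuous_data)+

lemma circle_fun_u: "t \<in> I \<Longrightarrow> circle_fun (\<lambda>\<theta>. u \<theta> t)"
  using solution by (simp add: solution_on_def)

lemma circle_fun_u1: "t \<in> I \<Longrightarrow> circle_fun (\<lambda>\<theta>. u1 \<theta> t)"
  using circle_fun_deriv[OF circle_fun_u] by (simp add: partial_deriv_def)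

lemma periodic_values:
  assumes "t \<in> I"
  shows "w (2 * pi) t = w 0 t" "w1 (2 * pi) t = w1 0 t"
proof -
  have "h (2 * pi) = h 0" if "circle_fun h" for h :: "real \<Rightarrow> real"
    using that by (metis circle_fun_def add_0)
  note this[OF circle_fun_u[OF assms]] this[OF circle_fun_u1[OF assms]] this[OF periodic]
    this[OF circle_fun_deriv[OF periodic]]
  then show "w (2 * pi) t = w 0 t" "w1 (2 * pi) t = w1 0 t"
    by (simp_all add: w_def w1_def)
qed

lemma \<rho>_0: "\<rho> \<theta> 0 = a \<theta> / u\<^sub>0 \<theta>"
  using solution f_0 by (simp add: \<rho>_def solution_on_def)

text \<open>
  The area \<open>A\<close> stays positive while \<open>A + 2 B t\<close> does not increase.
\<close>

lemma lifespan:
  assumes init: "integral {0..2 * pi} (\<lambda>\<theta>. a \<theta> / u\<^sub>0 \<theta> * sin \<theta>) = 0"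
    "integral {0..2 * pi} (\<lambda>\<theta>. a \<theta> / u\<^sub>0 \<theta> * cos \<theta>) = 0"
    and t: "t \<in> I"
  shows "t < curve_area (\<lambda>\<theta>. a \<theta> / u\<^sub>0 \<theta>) / (2 * enclosed_area (p_curve g))"
proof -
  define A where "A t = curve_area (\<lambda>\<theta>. \<rho> \<theta> t)" for t
  define B where "B = enclosed_area (p_curve g)"
  have B: "B > 0" using enclosed_area_p_pos by (simp add: B_def)
  have sin0: "integral {0..2 * pi} (\<lambda>\<theta>. \<rho> \<theta> s * sin \<theta>) = 0" if "s \<in> I" for s
    by (rule closure_flow[where \<rho> = \<rho> and w = w and ?w1.0 = w1 and ?w2.0 = w2 and e' = cos])
      (rule convex_I zero_in_I that \<rho>_continuous \<rho>_t w_theta w1_theta w_continuous w2_continuous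
          periodic_values | assumption | auto intro!: derivative_eq_intros simp: \<rho>_0 init[simplified])+
  have cos0: "integral {0..2 * pi} (\<lambda>\<theta>. \<rho> \<theta> s * cos \<theta>) = 0" if "s \<in> I" for s
    by (rule closure_flow[where \<rho> = \<rho> and w = w and ?w1.0 = w1 and ?w2.0 = w2 and e' = "\<lambda>\<theta>. - sin \<theta>"])
      (rule convex_I zero_in_I that \<rho>_continuous \<rho>_t w_theta w1_theta w_continuous w2_continuous
          periodic_values | assumption | auto intro!: derivative_eq_intros simp: \<rho>_0 init[simplified])+
  have A_pos: "A s > 0" if s: "s \<in> I" for s
  proof -
    have "circle_fun (\<lambda>\<theta>. \<rho> \<theta> s)"
      using circle_fun_u[OF s] circle_fun_a by (simp add: circle_fun_def \<rho>_def)
    moreover have "\<rho> \<theta> s > 0" for \<theta>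
      using u_pos[OF s] a_pos f_pos[OF s] by (simp add: \<rho>_def)
    ultimately obtain \<gamma> where "convex_curve \<gamma> (\<lambda>\<theta>. \<rho> \<theta> s)"
      using convex_curve_exists[OF continuous_on_slice[OF \<rho>_continuous s]] sin0[OF s] cos0[OF s] by metis
    then show ?thesis unfolding A_def by (rule convex_curve.curve_area_pos)
  qed
  have A_t: "(A has_real_derivative - 2 * B * (f s)\<^sup>2) (at s within I)" if s: "s \<in> I" for s
  proof -
    have "\<rho> \<theta> s * w \<theta> s = (f s)\<^sup>2 * (a \<theta> * g \<theta>)" for \<theta>
      using u_pos[OF s, of \<theta>] by (simp add: \<rho>_def w_def power2_eq_square)
    then have "integral {0..2 * pi} (\<lambda>\<theta>. \<rho> \<theta> s * w \<theta> s) = 2 * B * (f s)\<^sup>2"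
      using enclosed_area_p by (simp add: integral_unique B_def)
    with curve_area_flow[OF convex_I s \<rho>_continuous \<rho>_t w_theta w1_theta
          w_continuous w1_continuous w2_continuous sin0[OF s] cos0[OF s]]
    show ?thesis by (simp add: A_def[abs_def])
  qed
  have "A t + 2 * B * t \<le> A 0"
  proof (cases "t = 0")
    case False
    then have "0 < t" using I_nonneg[OF t] by simp
    have sub: "{0..t} \<subseteq> I" by (rule segment_subset_I[OF t])
    have "((\<lambda>s. A s + 2 * B * s) has_derivative (*) (2 * B * (1 - (f s)\<^sup>2))) (at s within {0..t})"
      if "0 \<le> s" "s \<le> t" for s
    proof -
      have "s \<in> I" using that sub by auto
      have "(A has_real_derivative - 2 * B * (f s)\<^sup>2) (at s within {0..t})"
        using A_t[OF \<open>s \<in> I\<close>] sub by (rule has_field_derivative_subset)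
      then have "((\<lambda>s. A s + 2 * B * s) has_real_derivative 2 * B * (1 - (f s)\<^sup>2)) (at s within {0..t})"
        by (auto intro!: derivative_eq_intros simp: algebra_simps)
      then show ?thesis by (simp add: has_field_derivative_def)
    qed
    from mvt_simple[OF \<open>0 < t\<close> this] obtain s where s: "s \<in> {0<..<t}"
      "A t + 2 * B * t - (A 0 + 2 * B * 0) = 2 * B * (1 - (f s)\<^sup>2) * (t - 0)" by auto
    then have "s \<in> I" using sub by auto
    then have "(f s)\<^sup>2 \<ge> 1" using f_ge_1 by (simp add: one_le_power)
    then have "2 * B * (1 - (f s)\<^sup>2) * (t - 0) \<le> 0"
      using B \<open>0 < t\<close> by (simp add: mult_nonneg_nonpos mult_nonpos_nonneg)
    with s(2) show ?thesis by linarith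
  qed simp
  with A_pos[OF t] have "2 * B * t < A 0" by simp
  then show ?thesis using B by (simp add: A_def B_def \<rho>_0 field_simps)
qed

end


section \<open>Extending a solution with bounded derivatives\<close>

lemma quadratic_remainder_imp_DERIV:
  fixes F :: "real \<Rightarrow> real"
  assumes "\<forall>\<^sub>F y in at x within S. \<bar>F y - F x - (y - x) * D\<bar> \<le> M * (y - x)\<^sup>2"
  shows "(F has_real_derivative D) (at x within S)"
  unfolding has_field_derivative_iff
proof (subst LIM_zero_iff[symmetric], rule Lim_null_comparison)
  show "\<forall>\<^sub>F y in at x within S. norm ((F y - F x) / (y - x) - D) \<le> M * \<bar>y - x\<bar>"
    using assms eventually_neq_at_within[of x x S]
  proof (eventually_elim)
    case (elim y)
    have "(F y - F x) / (y - x) - D = (F y - F x - (y - x) * D) / (y - x)"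
      using elim(2) by (simp add: field_simps)
    then have "norm ((F y - F x) / (y - x) - D) = \<bar>F y - F x - (y - x) * D\<bar> / \<bar>y - x\<bar>"
      by simp
    also have "\<dots> \<le> M * (y - x)\<^sup>2 / \<bar>y - x\<bar>"
      using elim(1) by (intro divide_right_mono) auto
    also have "\<dots> = M * \<bar>y - x\<bar>"
      using elim(2) by (simp add: power2_eq_square divide_simps)
    finally show ?case .
  qed
  show "((\<lambda>y. M * \<bar>y - x\<bar>) \<longlongrightarrow> 0) (at x within S)"
    by (auto intro!: tendsto_eq_intros)
qed

text \<open>
  A Taylor estimate with derivatives relative to \<open>S\<close>. Unlike a statement about derivatives, such an
  inequality passes to pointwise limits; together with \<open>quadratic_remainder_imp_DERIV\<close> this is how
  differentiability is transferred to the final time.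
\<close>

lemma quadratic_remainder_bound:
  fixes F G K :: "real \<Rightarrow> real"
  assumes S: "convex S" "x \<in> S" "y \<in> S"
    and F: "\<And>z. z \<in> S \<Longrightarrow> (F has_real_derivative G z) (at z within S)"
    and G: "\<And>z. z \<in> S \<Longrightarrow> (G has_real_derivative K z) (at z within S)"
    and K: "\<And>z. z \<in> S \<Longrightarrow> \<bar>K z\<bar> \<le> M"
  shows "\<bar>F y - F x - (y - x) * G x\<bar> \<le> M * (y - x)\<^sup>2"
proof -
  let ?T = "closed_segment x y"
  have T: "?T \<subseteq> S" using S by (simp add: closed_segment_subset)
  have M: "M \<ge> 0" using K[OF S(2)] by linarith
  have "norm ((F y - y * G x) - (F x - x * G x)) \<le> (M * \<bar>y - x\<bar>) * norm (y - x)"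
  proof (rule field_differentiable_bound[of ?T "\<lambda>z. F z - z * G x" "\<lambda>z. G z - G x"])
    fix z assume z: "z \<in> ?T"
    then have "(F has_real_derivative G z) (at z within ?T)"
      using F T by (blast intro: has_field_derivative_subset)
    then show "((\<lambda>z. F z - z * G x) has_real_derivative G z - G x) (at z within ?T)"
      by (auto intro!: derivative_eq_intros)
    have "norm (G z - G x) \<le> M * norm (z - x)"
      using z T by (intro field_differentiable_bound[OF S(1) G _ _ S(2)]) (auto simp: K)
    also have "\<dots> \<le> M * \<bar>y - x\<bar>"
      using z M by (intro mult_left_mono) (auto simp: closed_segment_eq_real_ivl split: if_splits)
    finally show "norm (G z - G x) \<le> M * \<bar>y - x\<bar>" .
  qed auto
  moreover have "M * \<bar>y - x\<bar> * norm (y - x) = M * (y - x)\<^sup>2" by (simp add: power2_eq_square)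
  moreover have "(F y - y * G x) - (F x - x * G x) = F y - F x - (y - x) * G x" by (simp add: algebra_simps)
  ultimately show ?thesis by (metis real_norm_def)
qed

text \<open>
  Smoothness on a strip is expressed through iterated derivative operators. When the expected values
  are known as a family of functions that are derivatives of one another, induction on the orders
  identifies the operators with them.
\<close>

lemma smooth_on_strip_of_family:
  assumes J: "\<And>t. t \<in> J \<Longrightarrow> at t within J \<noteq> bot"
    and v: "\<And>\<theta> t. t \<in> J \<Longrightarrow> v \<theta> t = V 0 0 \<theta> t"
    and cont: "\<And>i j. continuous_on (UNIV \<times> J) (\<lambda>(\<theta>, t). V i j \<theta> t)"
    and dx: "\<And>i j \<theta> t. t \<in> J \<Longrightarrow> ((\<lambda>x. V i j x t) has_real_derivative V (Suc i) j \<theta> t) (at \<theta>)"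
    and dt: "\<And>i j \<theta> t. t \<in> J \<Longrightarrow> (V i j \<theta> has_real_derivative V i (Suc j) \<theta> t) (at t within J)"
  shows "t \<in> J \<Longrightarrow> partial_deriv J i j v \<theta> t = V i j \<theta> t"
    and "smooth_on_strip J v"
proof -
  have t: "(deriv_on J ^^ j) (v \<theta>) t = V 0 j \<theta> t" if "t \<in> J" for \<theta> t j
    using that
  proof (induction j arbitrary: t)
    case (Suc j)
    have "((deriv_on J ^^ j) (v \<theta>) has_real_derivative V 0 (Suc j) \<theta> t) (at t within J)"
      by (rule has_field_derivative_transform_within[OF dt zero_less_one]) (simp_all add: Suc)
    then show ?case using J[OF Suc.prems] by (simp add: deriv_on_eqI)
  qed (simp add: v)
  have eq: "partial_deriv J i j v \<theta> t = V i j \<theta> t" if "t \<in> J" for i j \<theta> t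
    unfolding partial_deriv_def t[OF that]
  proof (induction i arbitrary: \<theta>)
    case (Suc i)
    then have "(deriv ^^ i) (\<lambda>x. V 0 j x t) = (\<lambda>x. V i j x t)" by auto
    then show ?case using dx[OF that] by (simp add: DERIV_imp_deriv)
  qed simp
  then show "t \<in> J \<Longrightarrow> partial_deriv J i j v \<theta> t = V i j \<theta> t" .
  show "smooth_on_strip J v"
    unfolding smooth_on_strip_def
  proof (intro allI ballI conjI)
    fix i j
    show "continuous_on (UNIV \<times> J) (\<lambda>(\<theta>, t). partial_deriv J i j v \<theta> t)"
      by (rule continuous_on_cong[THEN iffD2, OF refl _ cont[of i j]]) (auto simp: eq)
    fix \<theta> t assume "t \<in> J"
    then show "((\<lambda>x. partial_deriv J i j v x t) has_real_derivative partial_deriv J (Suc i) j v \<theta> t) (at \<theta>)"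
      using dx by (simp add: eq)
    show "((\<lambda>s. partial_deriv J i j v \<theta> s) has_real_derivative partial_deriv J i (Suc j) v \<theta> t) (at t within J)"
      unfolding eq[OF \<open>t \<in> J\<close>]
      by (rule has_field_derivative_transform_within[OF dt zero_less_one]) (simp_all add: eq \<open>t \<in> J\<close>)
  qed
qed

locale bounded_strip =
  fixes \<tau> :: real and u :: "real \<Rightarrow> real \<Rightarrow> real"
  assumes \<tau>_pos: "0 < \<tau>" and strip: "smooth_on_strip {0..<\<tau>} u"
    and no_blow_up: "\<not> blows_up_at u \<tau>"
begin

abbreviation "P \<equiv> \<lambda>i j. partial_deriv {0..<\<tau>} i j u"

lemma P_continuous: "continuous_on (UNIV \<times> {0..<\<tau>}) (\<lambda>(\<theta>, t). P i j \<theta> t)"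
  and P_theta: "t \<in> {0..<\<tau>} \<Longrightarrow> ((\<lambda>x. P i j x t) has_real_derivative P (Suc i) j \<theta> t) (at \<theta>)"
  and P_t: "t \<in> {0..<\<tau>} \<Longrightarrow> (P i j \<theta> has_real_derivative P i (Suc j) \<theta> t) (at t within {0..<\<tau>})"
  using strip unfolding smooth_on_strip_def by auto

lemma P_bound:
  obtains M c where "0 \<le> c" "c < \<tau>" "\<And>s \<theta>. s \<in> {c<..<\<tau>} \<Longrightarrow> \<bar>P i j \<theta> s\<bar> \<le> M"
proof -
  obtain M where "\<forall>\<^sub>F s in at_left \<tau>. \<forall>\<theta>. \<bar>P i j \<theta> s\<bar> \<le> M"
    using no_blow_up unfolding blows_up_at_def frequently_def by (auto simp: not_less)
  then obtain b where b: "b < \<tau>" "\<And>s \<theta>. b < s \<Longrightarrow> s < \<tau> \<Longrightarrow> \<bar>P i j \<theta> s\<bar> \<le> M"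
    unfolding eventually_at_left_field by blast
  show ?thesis
    by (rule that[of "max 0 b" M]) (use b \<tau>_pos in auto)
qed

lemma at_left_\<tau>:
  assumes "c < \<tau>"
  shows "at \<tau> within {c<..<\<tau>} = at_left \<tau>" "at \<tau> within {c<..\<tau>} = at_left \<tau>"
    "at \<tau> within {c..\<tau>} = at_left \<tau>"
  using assms by (auto intro!: at_within_nhd[of _ "{c<..}"])

definition "L i j \<theta> = Lim (at_left \<tau>) (P i j \<theta>)"

text \<open>
  A bound on the next time derivative makes each derivative of \<open>u\<close> Lipschitz in time near \<open>\<tau>\<close>.
\<close>

lemma P_tendsto: "(P i j \<theta> \<longlongrightarrow> L i j \<theta>) (at_left \<tau>)"
proof -
  obtain M c where c: "0 \<le> c" "c < \<tau>" and M: "\<And>s \<theta>. s \<in> {c<..<\<tau>} \<Longrightarrow> \<bar>P i (Suc j) \<theta> s\<bar> \<le> M"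
    by (rule P_bound[of i "Suc j"]) (rule that)
  have "\<bar>P i (Suc j) \<theta> ((c + \<tau>) / 2)\<bar> \<le> M" by (rule M) (use c in auto)
  then have "0 \<le> M" by linarith
  have "M-lipschitz_on {c<..<\<tau>} (P i j \<theta>)"
  proof (rule lipschitz_onI[OF _ \<open>0 \<le> M\<close>])
    fix x y assume xy: "x \<in> {c<..<\<tau>}" "y \<in> {c<..<\<tau>}"
    have "norm (P i j \<theta> x - P i j \<theta> y) \<le> M * norm (x - y)"
    proof (rule field_differentiable_bound[OF _ _ _ xy])
      fix z assume "z \<in> {c<..<\<tau>}"
      then show "(P i j \<theta> has_real_derivative P i (Suc j) \<theta> z) (at z within {c<..<\<tau>})"
        using c by (intro has_field_derivative_subset[OF P_t]) auto
    qed (use M in auto)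
    then show "dist (P i j \<theta> x) (P i j \<theta> y) \<le> M * dist x y" by (simp add: dist_norm)
  qed
  then have "uniformly_continuous_on {c<..<\<tau>} (P i j \<theta>)"
    by (rule lipschitz_on_uniformly_continuous)
  moreover have "\<tau> \<in> closure {c<..<\<tau>}" using c by simp
  ultimately obtain l where "(P i j \<theta> \<longlongrightarrow> l) (at_left \<tau>)"
    using uniformly_continuous_on_extension_at_closure[of "{c<..<\<tau>}" "P i j \<theta>" \<tau>] at_left_\<tau>(1)[OF c(2)] by metis
  moreover from this have "L i j \<theta> = l" unfolding L_def by (intro tendsto_Lim) auto
  ultimately show ?thesis by simp
qed

definition "V i j \<theta> t = (if t < \<tau> then P i j \<theta> t else L i j \<theta>)"

lemma V_tendsto: "(V i j \<theta> \<longlongrightarrow> V i j \<theta> \<tau>) (at_left \<tau>)"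
proof -
  have "\<forall>\<^sub>F s in at_left \<tau>. P i j \<theta> s = V i j \<theta> s"
    using eventually_at_left_real[OF \<tau>_pos] by eventually_elim (simp add: V_def)
  from tendsto_cong[THEN iffD1, OF this P_tendsto] have "(V i j \<theta> \<longlongrightarrow> L i j \<theta>) (at_left \<tau>)" .
  moreover have "V i j \<theta> \<tau> = L i j \<theta>" by (simp add: V_def)
  ultimately show ?thesis by simp
qed

lemma V_bound:
  obtains M c where "0 \<le> c" "c < \<tau>" "0 \<le> M" "\<And>s \<theta>. s \<in> {c<..\<tau>} \<Longrightarrow> \<bar>V i j \<theta> s\<bar> \<le> M"
proof -
  obtain M c where c: "0 \<le> c" "c < \<tau>" and M: "\<And>s \<theta>. s \<in> {c<..<\<tau>} \<Longrightarrow> \<bar>P i j \<theta> s\<bar> \<le> M"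
    by (rule P_bound[of i j]) (rule that)
  have "\<bar>V i j \<theta> \<tau>\<bar> \<le> M" for \<theta>
  proof (rule tendsto_upperbound[OF tendsto_rabs[OF V_tendsto]])
    show "\<forall>\<^sub>F s in at_left \<tau>. \<bar>V i j \<theta> s\<bar> \<le> M"
      using eventually_at_left_real[OF c(2)] by eventually_elim (simp add: V_def M)
  qed simp
  moreover from this[of 0] have "0 \<le> M" by linarith
  moreover have "\<bar>V i j \<theta> s\<bar> \<le> M" if "s \<in> {c<..\<tau>}" for s \<theta>
    using that M[of s] calculation(1) by (cases "s < \<tau>") (auto simp: V_def)
  ultimately show ?thesis using c that by blast
qed

text \<open>
  At \<open>\<tau>\<close> the remainder estimate is the limit of the estimates at times \<open>s < \<tau>\<close>. These
  hold with a constant independent of \<open>s\<close>, since the second derivative in \<open>\<theta>\<close> is bounded.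
\<close>

lemma V_theta:
  assumes t: "t \<in> {0..\<tau>}"
  shows "((\<lambda>x. V i j x t) has_real_derivative V (Suc i) j \<theta> t) (at \<theta>)"
proof (cases "t < \<tau>")
  case True
  then show ?thesis using P_theta[of t i j \<theta>] t by (simp add: V_def)
next
  case False
  then have "t = \<tau>" using t by simp
  obtain M c where c: "0 \<le> c" "c < \<tau>" "0 \<le> M" and M: "\<And>s \<theta>. s \<in> {c<..\<tau>} \<Longrightarrow> \<bar>V (Suc (Suc i)) j \<theta> s\<bar> \<le> M"
    by (rule V_bound[of "Suc (Suc i)" j]) (rule that)
  have "\<bar>V i j y \<tau> - V i j \<theta> \<tau> - (y - \<theta>) * V (Suc i) j \<theta> \<tau>\<bar> \<le> M * (y - \<theta>)\<^sup>2" for y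
  proof (rule tendsto_upperbound)
    show "((\<lambda>s. \<bar>V i j y s - V i j \<theta> s - (y - \<theta>) * V (Suc i) j \<theta> s\<bar>) \<longlongrightarrow>
        \<bar>V i j y \<tau> - V i j \<theta> \<tau> - (y - \<theta>) * V (Suc i) j \<theta> \<tau>\<bar>) (at_left \<tau>)"
      by (intro tendsto_intros V_tendsto)
    show "\<forall>\<^sub>F s in at_left \<tau>. \<bar>V i j y s - V i j \<theta> s - (y - \<theta>) * V (Suc i) j \<theta> s\<bar> \<le> M * (y - \<theta>)\<^sup>2"
      using eventually_at_left_real[OF c(2)]
    proof eventually_elim
      case (elim s)
      then have s: "s \<in> {0..<\<tau>}" "s \<in> {c<..\<tau>}" "s < \<tau>" using c by auto
      show ?case
      proof (rule quadratic_remainder_bound[where S = UNIV and K = "\<lambda>x. V (Suc (Suc i)) j x s"])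
        show "((\<lambda>x. V k j x s) has_real_derivative V (Suc k) j z s) (at z)" for k z
          using P_theta[OF s(1)] s(3) by (simp add: V_def)
        then show "((\<lambda>x. V (Suc i) j x s) has_real_derivative V (Suc (Suc i)) j z s) (at z)" for z .
      qed (use M[OF s(2)] in auto)
    qed
  qed simp
  then show ?thesis unfolding \<open>t = \<tau>\<close> by (intro quadratic_remainder_imp_DERIV always_eventually) auto
qed

text \<open>
  In time the point of expansion itself tends to \<open>\<tau>\<close>: the estimate between \<open>y\<close> and \<open>s\<close> becomes,
  as \<open>s \<rightarrow> \<tau>\<close>, the estimate between \<open>y\<close> and \<open>\<tau>\<close>.
\<close>

lemma V_t:
  assumes t: "t \<in> {0..\<tau>}"
  shows "(V i j \<theta> has_real_derivative V i (Suc j) \<theta> t) (at t within {0..\<tau>})"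
proof -
  have interior: "(V i j \<theta> has_real_derivative V i (Suc j) \<theta> t) (at t within {0..<\<tau>})"
    if t: "t \<in> {0..<\<tau>}" for t i j
  proof (rule has_field_derivative_transform_within[OF _ zero_less_one t])
    show "(P i j \<theta> has_real_derivative V i (Suc j) \<theta> t) (at t within {0..<\<tau>})"
      using P_t[OF t] t by (simp add: V_def)
  qed (simp add: V_def)
  show ?thesis
  proof (cases "t < \<tau>")
    case True
    have "at t within {0..\<tau>} = at t within {0..<\<tau>}"
      using True by (intro at_within_nhd[of _ "{..<\<tau>}"]) auto
    then show ?thesis using interior[of t] t True by simp
  next
    case False
    then have "t = \<tau>" using t by simp
    obtain M c where c: "0 \<le> c" "c < \<tau>" "0 \<le> M" and M: "\<And>s \<theta>. s \<in> {c<..\<tau>} \<Longrightarrow> \<bar>V i (Suc (Suc j)) \<theta> s\<bar> \<le> M"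
      by (rule V_bound[of i "Suc (Suc j)"]) (rule that)
    have "\<bar>V i j \<theta> y - V i j \<theta> \<tau> - (y - \<tau>) * V i (Suc j) \<theta> \<tau>\<bar> \<le> M * (y - \<tau>)\<^sup>2" if y: "y \<in> {c<..<\<tau>}" for y
    proof (rule tendsto_le[OF trivial_limit_at_left_real])
      show "((\<lambda>s. \<bar>V i j \<theta> y - V i j \<theta> s - (y - s) * V i (Suc j) \<theta> s\<bar>) \<longlongrightarrow>
          \<bar>V i j \<theta> y - V i j \<theta> \<tau> - (y - \<tau>) * V i (Suc j) \<theta> \<tau>\<bar>) (at_left \<tau>)"
        by (intro tendsto_intros V_tendsto)
      show "((\<lambda>s. M * (y - s)\<^sup>2) \<longlongrightarrow> M * (y - \<tau>)\<^sup>2) (at_left \<tau>)"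
        by (intro tendsto_intros)
      show "\<forall>\<^sub>F s in at_left \<tau>. \<bar>V i j \<theta> y - V i j \<theta> s - (y - s) * V i (Suc j) \<theta> s\<bar> \<le> M * (y - s)\<^sup>2"
        using eventually_at_left_real[OF c(2)]
      proof eventually_elim
        case (elim s)
        show ?case
        proof (rule quadratic_remainder_bound[OF _ elim y, where K = "V i (Suc (Suc j)) \<theta>"])
          fix z assume z: "z \<in> {c<..<\<tau>}"
          then show "\<bar>V i (Suc (Suc j)) \<theta> z\<bar> \<le> M" by (intro M) auto
          show "(V i j \<theta> has_real_derivative V i (Suc j) \<theta> z) (at z within {c<..<\<tau>})"
            "(V i (Suc j) \<theta> has_real_derivative V i (Suc (Suc j)) \<theta> z) (at z within {c<..<\<tau>})"
            using z c by (auto intro!: has_field_derivative_subset[OF interior])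
        qed simp
      qed
    qed
    then have "\<forall>\<^sub>F y in at_left \<tau>.
        \<bar>V i j \<theta> y - V i j \<theta> \<tau> - (y - \<tau>) * V i (Suc j) \<theta> \<tau>\<bar> \<le> M * (y - \<tau>)\<^sup>2"
      by (rule eventually_mono[OF eventually_at_left_real[OF c(2)]])
    then show ?thesis
      unfolding \<open>t = \<tau>\<close> at_left_\<tau>(3)[OF \<tau>_pos] by (rule quadratic_remainder_imp_DERIV)
  qed
qed

text \<open>
  Near the final time the functions are Lipschitz in both variables, because the next derivatives
  are bounded.
\<close>

lemma V_continuous: "continuous_on (UNIV \<times> {0..\<tau>}) (\<lambda>(\<theta>, t). V i j \<theta> t)"
  unfolding continuous_on_eq_continuous_within
proof clarify
  fix \<theta> t :: real assume t: "t \<in> {0..\<tau>}"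
  show "continuous (at (\<theta>, t) within UNIV \<times> {0..\<tau>}) (\<lambda>(\<theta>, t). V i j \<theta> t)"
  proof (cases "t < \<tau>")
    case True
    have "continuous_on (UNIV \<times> {0..<\<tau>}) (\<lambda>(\<theta>, t). V i j \<theta> t)"
      by (rule continuous_on_cong[THEN iffD2, OF refl _ P_continuous[of i j]]) (auto simp: V_def)
    moreover have "at (\<theta>, t) within UNIV \<times> {0..\<tau>} = at (\<theta>, t) within UNIV \<times> {0..<\<tau>}"
      using True by (intro at_within_nhd[of _ "UNIV \<times> {..<\<tau>}"]) (auto intro!: open_Times)
    ultimately show ?thesis
      using t True by (simp add: continuous_on_eq_continuous_within)
  next
    case False
    then have "t = \<tau>" using t by simp
    obtain M0 c0 where M0: "0 \<le> c0" "c0 < \<tau>" "0 \<le> M0" "\<And>s \<theta>. s \<in> {c0<..\<tau>} \<Longrightarrow> \<bar>V i (Suc j) \<theta> s\<bar> \<le> M0"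
      by (rule V_bound[of i "Suc j"]) (rule that)
    obtain M1 c1 where M1: "0 \<le> c1" "c1 < \<tau>" "0 \<le> M1" "\<And>s \<theta>. s \<in> {c1<..\<tau>} \<Longrightarrow> \<bar>V (Suc i) j \<theta> s\<bar> \<le> M1"
      by (rule V_bound[of "Suc i" j]) (rule that)
    define c where "c = max c0 c1"
    have c: "0 \<le> c" "c < \<tau>" "c0 \<le> c" "c1 \<le> c" using M0 M1 by (auto simp: c_def)
    have bound: "\<bar>V i j x s - V i j \<theta> \<tau>\<bar> \<le> M1 * \<bar>x - \<theta>\<bar> + M0 * \<bar>s - \<tau>\<bar>" if s: "s \<in> {c<..\<tau>}" for x s
    proof -
      have "norm (V i j x s - V i j \<theta> s) \<le> M1 * norm (x - \<theta>)"
      proof (rule field_differentiable_bound[of UNIV "\<lambda>x. V i j x s" "\<lambda>x. V (Suc i) j x s"])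
        show "((\<lambda>x. V i j x s) has_real_derivative V (Suc i) j z s) (at z)" for z
          using s c by (intro V_theta) auto
      qed (use M1(4)[of s] s c in auto)
      moreover have "norm (V i j \<theta> s - V i j \<theta> \<tau>) \<le> M0 * norm (s - \<tau>)"
      proof (rule field_differentiable_bound[of "{c<..\<tau>}" "V i j \<theta>" "V i (Suc j) \<theta>"])
        fix z assume z: "z \<in> {c<..\<tau>}"
        show "(V i j \<theta> has_real_derivative V i (Suc j) \<theta> z) (at z within {c<..\<tau>})"
          using z c by (intro has_field_derivative_subset[OF V_t]) auto
        show "norm (V i (Suc j) \<theta> z) \<le> M0" using M0(4)[of z \<theta>] z c by simp
      qed (use s c in auto)
      ultimately show ?thesis by simp
    qed
    have "((\<lambda>p. V i j (fst p) (snd p)) \<longlongrightarrow> V i j \<theta> \<tau>) (at (\<theta>, \<tau>) within UNIV \<times> {0..\<tau>})"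
    proof (subst LIM_zero_iff[symmetric], rule Lim_null_comparison)
      have "\<forall>\<^sub>F p in at (\<theta>, \<tau>) within UNIV \<times> {0..\<tau>}. p \<in> UNIV \<times> {c<..}"
        by (rule topological_tendstoD[OF tendsto_ident_at]) (use c in \<open>auto intro!: open_Times\<close>)
      moreover have "\<forall>\<^sub>F p in at (\<theta>, \<tau>) within UNIV \<times> {0..\<tau>}. p \<in> UNIV \<times> {0..\<tau>}"
        by (simp add: eventually_at_filter)
      ultimately show "\<forall>\<^sub>F p in at (\<theta>, \<tau>) within UNIV \<times> {0..\<tau>}.
          norm (V i j (fst p) (snd p) - V i j \<theta> \<tau>) \<le> M1 * \<bar>fst p - \<theta>\<bar> + M0 * \<bar>snd p - \<tau>\<bar>"
        by eventually_elim (auto intro!: bound)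
      have "((\<lambda>p. M1 * \<bar>fst p - \<theta>\<bar> + M0 * \<bar>snd p - \<tau>\<bar>) \<longlongrightarrow>
          M1 * \<bar>fst (\<theta>, \<tau>) - \<theta>\<bar> + M0 * \<bar>snd (\<theta>, \<tau>) - \<tau>\<bar>) (at (\<theta>, \<tau>) within UNIV \<times> {0..\<tau>})"
        by (intro tendsto_intros)
      then show "((\<lambda>p. M1 * \<bar>fst p - \<theta>\<bar> + M0 * \<bar>snd p - \<tau>\<bar>) \<longlongrightarrow> 0) (at (\<theta>, \<tau>) within UNIV \<times> {0..\<tau>})"
        by simp
    qed
    then show ?thesis unfolding \<open>t = \<tau>\<close> continuous_within split_beta by simp
  qed
qed

lemma V_smooth:
  shows "t \<in> {0..\<tau>} \<Longrightarrow> partial_deriv {0..\<tau>} i j (V 0 0) \<theta> t = V i j \<theta> t"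
    and "smooth_on_strip {0..\<tau>} (V 0 0)"
proof -
  have "at t within {0..\<tau>} \<noteq> bot" if "t \<in> {0..\<tau>}" for t
    using that \<tau>_pos by (simp add: trivial_limit_within islimpt_Icc)
  note * = smooth_on_strip_of_family[where J = "{0..\<tau>}" and v = "V 0 0" and V = V, OF this refl V_continuous V_theta V_t]
  show "t \<in> {0..\<tau>} \<Longrightarrow> partial_deriv {0..\<tau>} i j (V 0 0) \<theta> t = V i j \<theta> t"
    "smooth_on_strip {0..\<tau>} (V 0 0)" using * by blast+
qed

lemma V_closure_eq:
  assumes "continuous_on {0..\<tau>} h" "\<And>t. t \<in> {0..<\<tau>} \<Longrightarrow> h t = 0" "t \<in> {0..\<tau>}"
  shows "h t = (0::real)"
  using continuous_constant_on_closure[of "{0..<\<tau>}" h 0 t] assms \<tau>_pos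
  by (simp add: closure_atLeastLessThan)

lemma V_slice: "continuous_on {0..\<tau>} (V i j \<theta>)"
  by (rule continuous_on_strip_compose[OF V_continuous, of _ "\<lambda>_. \<theta>" "\<lambda>t. t"]) (auto intro!: continuous_intros)

text \<open>
  Periodicity and the differential equation are closed conditions, so they pass to \<open>t = \<tau>\<close> by
  continuity in time.
\<close>

theorem solution_extends:
  assumes f: "f \<in> family_F" and sol: "solution_on g f u\<^sub>0 {0..<\<tau>} u"
  shows "solution_on g f u\<^sub>0 {0..\<tau>} (V 0 0)" "t \<in> {0..<\<tau>} \<Longrightarrow> V 0 0 \<theta> t = u \<theta> t"
proof -
  let ?f' = "deriv_on {0..} f"
  show V00: "V 0 0 \<theta> t = u \<theta> t" if "t \<in> {0..<\<tau>}" for \<theta> t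
    using that by (simp add: V_def partial_deriv_def)
  have V01: "deriv_on {0..\<tau>} (V 0 0 \<theta>) t = V 0 1 \<theta> t" and V10: "deriv (\<lambda>x. V 0 0 x t) \<theta> = V 1 0 \<theta> t"
    and V20: "deriv (deriv (\<lambda>x. V 0 0 x t)) \<theta> = V 2 0 \<theta> t" if "t \<in> {0..\<tau>}" for \<theta> t
    using V_smooth(1)[OF that, of 0 1 \<theta>] V_smooth(1)[OF that, of 1 0 \<theta>] V_smooth(1)[OF that, of 2 0 \<theta>]
    by (simp_all add: partial_deriv_def numeral_2_eq_2)
  have per: "V 0 0 (\<theta> + 2 * pi) t - V 0 0 \<theta> t = 0" if "t \<in> {0..\<tau>}" for \<theta> t
  proof (rule V_closure_eq[OF _ _ that])
    show "continuous_on {0..\<tau>} (\<lambda>t. V 0 0 (\<theta> + 2 * pi) t - V 0 0 \<theta> t)"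
      by (intro continuous_intros V_slice)
  qed (use sol in \<open>auto simp: solution_on_def circle_fun_def V00\<close>)
  have pde: "V 0 1 \<theta> t - (g \<theta> / (g \<theta> + deriv (deriv g) \<theta>) * (V 0 0 \<theta> t)\<^sup>2 * V 2 0 \<theta> t
      + 2 * deriv g \<theta> / (g \<theta> + deriv (deriv g) \<theta>) * (V 0 0 \<theta> t)\<^sup>2 * V 1 0 \<theta> t
      + (V 0 0 \<theta> t) ^ 3 + ?f' t / f t * V 0 0 \<theta> t) = 0" if t: "t \<in> {0..\<tau>}" for \<theta> t
  proof (rule V_closure_eq[OF _ _ t])
    have "{0..\<tau>} \<subseteq> {0..}" by auto
    note cf = family_F_continuous[OF f, THEN continuous_on_subset, OF this]
    have "f t \<noteq> 0" if "t \<in> {0..\<tau>}" for t using f that by (auto simp: family_F_def)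
    then show "continuous_on {0..\<tau>} (\<lambda>t. V 0 1 \<theta> t - (g \<theta> / (g \<theta> + deriv (deriv g) \<theta>) * (V 0 0 \<theta> t)\<^sup>2 * V 2 0 \<theta> t
      + 2 * deriv g \<theta> / (g \<theta> + deriv (deriv g) \<theta>) * (V 0 0 \<theta> t)\<^sup>2 * V 1 0 \<theta> t
      + (V 0 0 \<theta> t) ^ 3 + ?f' t / f t * V 0 0 \<theta> t))"
      by (intro continuous_on_diff continuous_on_add continuous_on_mult continuous_on_divide
          continuous_on_power continuous_on_const V_slice cf) auto
    fix t assume t: "t \<in> {0..<\<tau>}"
    have "P 0 1 \<theta> t = deriv_on {0..<\<tau>} (u \<theta>) t" "P 1 0 \<theta> t = deriv (\<lambda>x. u x t) \<theta>"
      "P 2 0 \<theta> t = deriv (deriv (\<lambda>x. u x t)) \<theta>"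
      by (simp_all add: partial_deriv_def numeral_2_eq_2)
    with sol t show "V 0 1 \<theta> t - (g \<theta> / (g \<theta> + deriv (deriv g) \<theta>) * (V 0 0 \<theta> t)\<^sup>2 * V 2 0 \<theta> t
      + 2 * deriv g \<theta> / (g \<theta> + deriv (deriv g) \<theta>) * (V 0 0 \<theta> t)\<^sup>2 * V 1 0 \<theta> t
      + (V 0 0 \<theta> t) ^ 3 + ?f' t / f t * V 0 0 \<theta> t) = 0"
      unfolding V00[OF t] by (simp add: V_def solution_on_def)
  qed
  show "solution_on g f u\<^sub>0 {0..\<tau>} (V 0 0)"
    unfolding solution_on_def
  proof (intro conjI allI ballI)
    show "is_interval {0..\<tau>}" by (rule is_interval_cc)
    show "0 \<in> {0..\<tau>}" "{0..\<tau>} \<subseteq> {0..}" "{0..\<tau>} \<noteq> {0}" using \<tau>_pos by auto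
    show "circle_fun (\<lambda>\<theta>. V 0 0 \<theta> t)" if "t \<in> {0..\<tau>}" for t
      using per[OF that] by (simp add: circle_fun_def)
    show "smooth_on_strip {0..\<tau>} (V 0 0)" by (rule V_smooth)
    show "V 0 0 \<theta> 0 = u\<^sub>0 \<theta>" for \<theta> using sol \<tau>_pos V00[of 0 \<theta>] by (simp add: solution_on_def)
    show "deriv_on {0..\<tau>} (V 0 0 \<theta>) t =
          g \<theta> / (g \<theta> + deriv (deriv g) \<theta>) * (V 0 0 \<theta> t)\<^sup>2 * deriv (deriv (\<lambda>x. V 0 0 x t)) \<theta>
          + 2 * deriv g \<theta> / (g \<theta> + deriv (deriv g) \<theta>) * (V 0 0 \<theta> t)\<^sup>2 * deriv (\<lambda>x. V 0 0 x t) \<theta>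
          + (V 0 0 \<theta> t) ^ 3 + ?f' t / f t * V 0 0 \<theta> t" if "t \<in> {0..\<tau>}" for \<theta> t
      using pde[OF that, of \<theta>] unfolding V01[OF that] V10[OF that] V20[OF that] by simp
  qed
qed

end

lemma maximal_solution_blows_up:
  assumes f: "f \<in> family_F" and max: "maximal_solution g f u\<^sub>0 (ereal \<tau>) u" and "0 < \<tau>"
  shows "blows_up_at u \<tau>"
proof (rule ccontr)
  assume "\<not> blows_up_at u \<tau>"
  have I: "time_interval (ereal \<tau>) = {0..<\<tau>}" by (auto simp: time_interval_def)
  have sol: "solution_on g f u\<^sub>0 {0..<\<tau>} u" using max by (simp add: maximal_solution_def I)
  interpret bounded_strip \<tau> u
    by standard (use \<open>0 < \<tau>\<close> \<open>\<not> blows_up_at u \<tau>\<close> sol in \<open>auto simp: solution_on_def\<close>)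
  have "{0..<\<tau>} \<subset> {0..\<tau>}" using \<open>0 < \<tau>\<close> by auto
  with solution_extends[OF f sol] max show False
    unfolding maximal_solution_def I by blast
qed


section \<open>The bound on the blow-up time\<close>

theorem corollary3p2:
  fixes g u\<^sub>0 :: "real \<Rightarrow> real"
  assumes "smooth_on UNIV g" and "\<And>\<theta>. g (\<theta> + pi) = g \<theta>"
    and "\<And>\<theta>. g \<theta> > 0" and "\<And>\<theta>. g \<theta> + deriv (deriv g) \<theta> > 0"
    and "smooth_on UNIV u\<^sub>0" and "circle_fun u\<^sub>0" and "\<And>\<theta>. u\<^sub>0 \<theta> > 0"
    and "integral {0..2 * pi} (\<lambda>\<theta>. (g \<theta> + deriv (deriv g) \<theta>) / u\<^sub>0 \<theta> * sin \<theta>) = 0"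
    and "integral {0..2 * pi} (\<lambda>\<theta>. (g \<theta> + deriv (deriv g) \<theta>) / u\<^sub>0 \<theta> * cos \<theta>) = 0"
  shows "\<exists>T::real.
      (\<exists>\<gamma>. has_minkowskian_curvature g \<gamma> u\<^sub>0) \<and>
      (\<forall>\<gamma>. has_minkowskian_curvature g \<gamma> u\<^sub>0 \<longrightarrow>
         T = enclosed_area \<gamma> / (2 * enclosed_area (p_curve g))) \<and>
      (\<forall>f\<in>family_F.
         (\<forall>I u. solution_on g f u\<^sub>0 I u \<longrightarrow> I \<subseteq> {0..<T}) \<and>
         (\<forall>\<tau> u. maximal_solution g f u\<^sub>0 \<tau> u \<longrightarrow>
            (\<exists>t. \<tau> = ereal t \<and> 0 < t \<and> t \<le> T \<and> blows_up_at u t)))"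
proof -
  have "g (\<theta> + 2 * pi) = g \<theta>" for \<theta>
    using assms(2)[of \<theta>] assms(2)[of "\<theta> + pi"] by (simp add: add.assoc)
  then interpret minkowski_norm g
    by unfold_locales (use assms(1,3,4) in \<open>auto simp: circle_fun_def\<close>)
  have cu0: "continuous_on UNIV u\<^sub>0"
    using smooth_on_UNIV_DERIV[OF assms(5), of 0]
    by (auto intro!: continuous_at_imp_continuous_on DERIV_isCont)
  have u0: "u\<^sub>0 \<theta> \<noteq> 0" for \<theta> using assms(7)[of \<theta>] by simp
  let ?\<rho> = "\<lambda>\<theta>. a \<theta> / u\<^sub>0 \<theta>"
  note curvature = has_minkowskian_curvature_iff[OF cu0 assms(7)]
  note init = assms(8,9)[folded a_def]
  define T where "T = curve_area ?\<rho> / (2 * enclosed_area (p_curve g))"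
  have "continuous_on UNIV ?\<rho>"
    by (intro continuous_intros continuous_a cu0) (simp add: u0)
  moreover have "circle_fun ?\<rho>"
    using circle_fun_a assms(6) by (simp add: circle_fun_def)
  moreover have "?\<rho> \<theta> > 0" for \<theta> using a_pos assms(7) by simp
  ultimately obtain \<gamma> where \<gamma>: "convex_curve \<gamma> ?\<rho>"
    using convex_curve_exists[of ?\<rho>] init by blast
  have lifespan: "I \<subseteq> {0..<T}" if "f \<in> family_F" and sol: "solution_on g f u\<^sub>0 I u" for f I u
  proof -
    interpret curvature_solution g f u\<^sub>0 I u
      by unfold_locales (use that assms(7) in auto)
    show ?thesis using lifespan[OF init] I_nonneg by (auto simp: T_def)
  qed
  show ?thesis
  proof (rule exI[of _ T], intro conjI ballI allI impI)
    show "\<exists>\<gamma>. has_minkowskian_curvature g \<gamma> u\<^sub>0" using \<gamma> curvature by blast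
  next
    fix \<gamma> assume "has_minkowskian_curvature g \<gamma> u\<^sub>0"
    then have "convex_curve \<gamma> ?\<rho>" by (simp add: curvature)
    then show "T = enclosed_area \<gamma> / (2 * enclosed_area (p_curve g))"
      by (simp add: T_def convex_curve.enclosed_area_eq_curve_area)
  next
    fix f I u assume "f \<in> family_F" "solution_on g f u\<^sub>0 I u"
    then show "I \<subseteq> {0..<T}" by (rule lifespan)
  next
    fix f \<tau> u assume f: "f \<in> family_F" and max: "maximal_solution g f u\<^sub>0 \<tau> u"
    have sol: "solution_on g f u\<^sub>0 (time_interval \<tau>) u"
      using max by (simp add: maximal_solution_def)
    then have I: "time_interval \<tau> \<subseteq> {0..<T}" "0 \<in> time_interval \<tau>"
      using lifespan[OF f] by (auto simp: solution_on_def)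
    then have "0 < \<tau>" "0 < T" by (auto simp: time_interval_def zero_ereal_def)
    have "\<tau> \<le> ereal T"
    proof (rule ccontr)
      assume "\<not> \<tau> \<le> ereal T"
      then have "T \<in> time_interval \<tau>" using \<open>0 < T\<close> by (simp add: time_interval_def not_le)
      with I(1) show False by auto
    qed
    with \<open>0 < \<tau>\<close> obtain t where t: "\<tau> = ereal t" "0 < t" "t \<le> T"
      by (cases \<tau>) auto
    with maximal_solution_blows_up[OF f] max
    show "\<exists>t. \<tau> = ereal t \<and> 0 < t \<and> t \<le> T \<and> blows_up_at u t" by blast
  qed
qed

end
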